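(* Let $(\eta_t)_{t\ge0}$ be median dynamics on the graph $\mathbb Z$ (vertices are the integers, $x\sim y$ iff $|x-y|=1$), and let $x\in\mathbb Z$. Then: (i) For every $\alpha\in[0,\tfrac12]$, the function $t\mapsto \mathbb P[\eta_t(x)\in[0,\alpha)]$ is monotone non-increasing on $[0,\infty)$. (ii) For every $t\ge0$, the distribution of $\eta_t(x)$ has a density $p_t$ with respect to Lebesgue measure on $[0,1]$ that is symmetric around $\tfrac12$ (that is, $p_t(u)=p_t(1-u)$) and monotone non-decreasing on $[0,\tfrac12]$.
   Context: For a vertex $x$ of a graph, $N(x)$ is the set of neighbors of $x$, with the convention that $x$ itself is added to $N(x)$ if its degree is even, so that $|N(x)|$ is always odd (in particular, on $\mathbb Z$, $N(x)=\{x-1,x,x+1\}$). Median dynamics $(\eta_t)_{t\ge0}$ on a graph with vertex set $V$ has state space $[0,1]^{V}$. The initial values $(\eta_0(x))_{x\in V}$ are i.i.d. uniform on $[0,1]$. Independently, each vertex has an independent rate-one Poisson clock. At each ring $s$ of the clock of $x$, the value at $x$ is replaced by the median of $\{\eta_{s-}(z): z\in N(x)\}$ (counted with multiplicity), and no other value changes. On $\mathbb Z$ this is well defined: almost surely each $\eta_t(x)$ is determined by finitely many initial values and clock rings. *)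

theory Defs
  imports "HOL-Probability.Probability"
begin

definition median :: "real multiset \<Rightarrow> real" where
  "median A = sorted_list_of_multiset A ! (size A div 2)"

(* The graph has the whole type as its vertex set and is given by its adjacency relation. *)
definition nbhd :: "('v \<Rightarrow> 'v \<Rightarrow> bool) \<Rightarrow> 'v \<Rightarrow> 'v set" where
  "nbhd E x = (if even (card {y. E x y}) then insert x {y. E x y} else {y. E x y})"

(* R n is the n-th ring time (counted from 0), so the first waiting time starts at time 0. *)
fun waiting_time :: "(nat \<Rightarrow> 'w \<Rightarrow> real) \<Rightarrow> nat \<Rightarrow> 'w \<Rightarrow> real" where
  "waiting_time R 0 \<omega> = R 0 \<omega>"
| "waiting_time R (Suc n) \<omega> = R (Suc n) \<omega> - R n \<omega>"

(* T x n is the n-th ring time of the clock of x, and \<eta> t x is the value at x at time t.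
   The clock of x is a rate-one Poisson process because its waiting times are independent
   and exponentially distributed with parameter 1. The assumption independent makes the
   initial values and all the waiting times of all the clocks one independent family.

   Almost surely the rings of a clock do not accumulate, so constant_between_rings makes the
   left limits in update_at_ring exist. These two rules describe a solution of the dynamics;
   on the integers it is almost surely unique, since almost surely for every t there are
   vertices arbitrarily far out on both sides whose clock does not ring before t. *)
locale median_dynamics = prob_space M
  for M :: "'w measure"
    and E :: "'v \<Rightarrow> 'v \<Rightarrow> bool"
    and T :: "'v \<Rightarrow> nat \<Rightarrow> 'w \<Rightarrow> real"
    and \<eta> :: "real \<Rightarrow> 'v \<Rightarrow> 'w \<Rightarrow> real" +
  assumes graph_sym: "E x y \<Longrightarrow> E y x"
    and graph_irrefl: "\<not> E x x"
    and locally_finite: "finite {y. E x y}"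
    and measurable_value: "t \<ge> 0 \<Longrightarrow> random_variable borel (\<eta> t x)"
    and state_space: "t \<ge> 0 \<Longrightarrow> \<omega> \<in> space M \<Longrightarrow> \<eta> t x \<omega> \<in> {0..1}"
    and initial_uniform: "distr M borel (\<eta> 0 x) = uniform_measure lborel {0..1}"
    and waiting_exponential:
      "distributed M lborel (waiting_time (T x) n) (exponential_density 1)"
    and independent:
      "indep_vars (\<lambda>_. borel)
         (case_sum (\<lambda>x. \<eta> 0 x) (\<lambda>(x, n). waiting_time (T x) n))
         (UNIV :: ('v + 'v \<times> nat) set)"
    and constant_between_rings:
      "AE \<omega> in M. \<forall>x s t. 0 \<le> s \<and> s < t \<and> (\<forall>n. T x n \<omega> \<notin> {s<..t})
         \<longrightarrow> \<eta> t x \<omega> = \<eta> s x \<omega>"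
    and update_at_ring:
      "AE \<omega> in M. \<forall>x n. \<eta> (T x n \<omega>) x \<omega> =
         median (image_mset (\<lambda>z. Lim (at_left (T x n \<omega>)) (\<lambda>r. \<eta> r z \<omega>))
                            (mset_set (nbhd E x)))"

definition int_adj :: "int \<Rightarrow> int \<Rightarrow> bool" where
  "int_adj x y \<longleftrightarrow> \<bar>x - y\<bar> = 1"

lemma nbhd_int_adj: "nbhd int_adj x = {x - 1, x, x + 1}"
proof -
  have "{y. int_adj x y} = {x - 1, x + 1}"
    by (auto simp: int_adj_def)
  then show ?thesis
    by (auto simp: nbhd_def)
qed

end

theory Submission
  imports Defs
begin

text \<open>
  Fix a threshold \<open>a\<close> and colour a site according to whether its value is at most \<open>a\<close>. The median
  commutes with thresholding, so the colours perform the majority dynamics on the integers, started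
  from independent colours. Two adjacent sites of equal colour never change again
  (\<open>equal_pair_frozen\<close>). After its first ring a site agrees with one of its neighbours, so a site
  changes colour at most once, namely at its first ring, and it does so exactly if both neighbours
  disagree with it just before (\<open>col_eq\<close>). Hence the colours are a function of the initial values
  and the first ring times.

  As long as a site \<open>x\<close> of initial colour \<open>c\<close> has not rung, the half-lines to its left and to its
  right evolve independently of each other. The neighbour still disagrees at time \<open>s\<close> if and only if
  it disagreed initially and has not changed its colour; and it changes colour if and only if it
  rings at some time \<open>u < s\<close> and its own next neighbour still disagrees with it at time \<open>u\<close>
  (\<open>disagreement_rec\<close>). So the probabilities \<open>F c s\<close> that the neighbour disagrees at time \<open>s\<close>, given
  that \<open>x\<close> has colour \<open>c\<close> and has not rung before, satisfy
  \<open>F c s = P (colour \<noteq> c) * (1 - \<integral>u=0..s. exp (- u) * F (\<not> c) u)\<close>.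
  In the variable \<open>1 - exp (- s)\<close> this is a linear system with a solution in terms of \<open>cosh\<close> and
  \<open>sinh\<close> (\<open>disagree_limit\<close>).

  Sites of initial colour \<open>c\<close> change colour at time \<open>s\<close> at rate \<open>exp (- s) * P (colour = c) * (F c s)\<^sup>2\<close>. The
  decisive point is a conservation law: up to the factor \<open>exp (- s)\<close> the difference of the two rates,
  \<open>a * (F True s)\<^sup>2 - (1 - a) * (F False s)\<^sup>2\<close>, does not depend on \<open>s\<close> and hence keeps its value
  \<open>a * (1 - a) * (1 - 2 * a)\<close> from time 0 (\<open>disagree_limit_conserved\<close>). Integrating over the ring
  time gives the distribution function
  \<open>P (\<eta> t x \<le> a) = a - (1 - exp (- t)) * (a * (1 - a) * (1 - 2 * a))\<close> (\<open>prob_value_le\<close>).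
  Its derivative \<open>exp (- t) + (1 - exp (- t)) * (6 * a * (1 - a))\<close> is a mixture of the uniform density
  and the density of the median of three independent uniform variables. It is symmetric around
  \<open>1 / 2\<close> and increasing up to there, and for \<open>a \<le> 1 / 2\<close> the distribution function decreases in \<open>t\<close>.

  The recursion along a half-line does not stop at a fixed distance. It is cut off at depth \<open>n\<close>, which
  changes nothing if one of the first \<open>n\<close> sites of the half-line has its first ring after \<open>t\<close>; the
  error is thus geometrically small (\<open>prob_le_approx\<close>), and \<open>n\<close> tends to infinity at the end.
\<close>

section \<open>Colours along a single trajectory\<close>

definition maj :: "bool \<Rightarrow> bool \<Rightarrow> bool \<Rightarrow> bool" where
  "maj p q r \<longleftrightarrow> p \<and> q \<or> q \<and> r \<or> p \<and> r"

lemma median_le_iff: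
  fixes u v w a :: real
  shows "median {#u, v, w#} \<le> a \<longleftrightarrow> maj (u \<le> a) (v \<le> a) (w \<le> a)"
proof -
  have "sorted_list_of_multiset {#u, v, w#} = sort [u, v, w]"
    by (metis mset.simps sorted_list_of_multiset_mset)
  moreover have "Suc (Suc (Suc 0)) div 2 = Suc 0"
    by simp
  ultimately have "median {#u, v, w#} = sort [u, v, w] ! Suc 0"
    by (simp add: median_def)
  then show ?thesis
    by (auto simp: maj_def)
qed

text \<open>
  What holds almost surely for the ring times and the values of a single sample point, together with
  the threshold \<open>a\<close>.
\<close>

locale threshold_path =
  fixes T :: "int \<Rightarrow> nat \<Rightarrow> real" and h :: "real \<Rightarrow> int \<Rightarrow> real" and a :: real
  assumes ring_pos: "0 < T y n"
    and first_ring_le: "T y 0 \<le> T y n"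
    and finite_rings: "finite {n. T y n \<le> t}"
    and first_ring_alone: "y \<noteq> z \<Longrightarrow> T y 0 \<noteq> T z n"
    and stays: "0 \<le> s \<Longrightarrow> s < t \<Longrightarrow> (\<forall>n. T y n \<notin> {s<..t}) \<Longrightarrow> h t y = h s y"
    and update: "h (T y n) y = median (image_mset (\<lambda>z. Lim (at_left (T y n)) (\<lambda>r. h r z))
                                (mset_set {y - 1, y, y + 1}))"
begin

definition col :: "real \<Rightarrow> int \<Rightarrow> bool" where
  "col t y \<longleftrightarrow> h t y \<le> a"

definition col_before :: "real \<Rightarrow> int \<Rightarrow> bool" where
  "col_before t y \<longleftrightarrow> Lim (at_left t) (\<lambda>r. h r y) \<le> a"

lemma finite_ring_times: "finite (T y ` {n. T y n \<le> t})"
  using finite_rings by blast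

lemma ring_free_before:
  assumes "0 < r"
  obtains s where "0 \<le> s" "s < r" "\<forall>n. T y n \<notin> {s<..<r}"
proof -
  let ?R = "insert 0 (T y ` {n. T y n \<le> r} \<inter> {..<r})"
  have fin: "finite ?R"
    using finite_ring_times by blast
  show ?thesis
  proof
    show "0 \<le> Max ?R" using fin by (intro Max_ge) auto
    show "Max ?R < r" using fin assms by (subst Max_less_iff) auto
    show "\<forall>n. T y n \<notin> {Max ?R<..<r}"
    proof (rule allI, rule notI)
      fix n assume "T y n \<in> {Max ?R<..<r}"
      then have "T y n \<in> ?R" "Max ?R < T y n" by auto
      with fin show False by (meson Max_ge not_less)
    qed
  qed
qed

lemma ring_free_after:
  obtains s where "r < s" "\<forall>n. T y n \<notin> {r<..s}"
proof -
  let ?R = "insert (r + 1) (T y ` {n. T y n \<le> r + 1} \<inter> {r<..})"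
  have fin: "finite ?R"
    using finite_ring_times by blast
  have m: "r < Min ?R"
    using fin by (subst Min_gr_iff) auto
  show ?thesis
  proof
    show "r < (r + Min ?R) / 2" using m by simp
    show "\<forall>n. T y n \<notin> {r<..(r + Min ?R) / 2}"
    proof (rule allI, rule notI)
      fix n assume *: "T y n \<in> {r<..(r + Min ?R) / 2}"
      moreover have "Min ?R \<le> r + 1" using fin by (intro Min_le) auto
      ultimately have "T y n \<in> ?R" using m by auto
      then have "Min ?R \<le> T y n" using fin by (intro Min_le) auto
      with * m show False by auto
    qed
  qed
qed

lemma constant_col:
  assumes "0 \<le> s" "s \<le> t" "\<forall>n. T y n \<notin> {s<..t}"
  shows "col t y = col s y"
  using stays[of s t y] assms by (cases "s = t") (auto simp: col_def)

lemma constant_before: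
  assumes "0 \<le> s" "s < r" "\<forall>n. T y n \<notin> {s<..<r}"
  shows "col_before r y = col s y"
proof -
  have "eventually (\<lambda>t. h t y = h s y) (at_left r)"
    using eventually_at_left_real[OF \<open>s < r\<close>]
  proof eventually_elim
    case (elim t)
    then show ?case using assms by (intro stays) auto
  qed
  then have "((\<lambda>t. h t y) \<longlongrightarrow> h s y) (at_left r)"
    by (rule tendsto_eventually)
  then show ?thesis
    unfolding col_before_def col_def by (subst tendsto_Lim) auto
qed

lemma col_before_eventually:
  assumes "0 < r"
  shows "eventually (\<lambda>s. 0 \<le> s \<and> s < r \<and> col s y = col_before r y) (at_left r)"
proof -
  obtain s where s: "0 \<le> s" "s < r" "\<forall>n. T y n \<notin> {s<..<r}"
    using ring_free_before[OF assms] by blast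
  show ?thesis
    using eventually_at_left_real[OF \<open>s < r\<close>]
  proof eventually_elim
    case (elim t)
    with s have "col_before r y = col t y"
      by (intro constant_before) auto
    with elim s show ?case by auto
  qed
qed

lemma col_at_other_time:
  assumes "0 < r" "\<forall>n. T y n \<noteq> r"
  shows "col r y = col_before r y"
proof -
  obtain s where s: "0 \<le> s" "s < r" "\<forall>n. T y n \<notin> {s<..<r}"
    using ring_free_before[OF \<open>0 < r\<close>] by blast
  then have "col r y = col s y"
    using assms(2) by (intro constant_col) (auto simp: less_le)
  with constant_before[OF s] show ?thesis by simp
qed

lemma col_at_ring:
  assumes "d = 1 \<or> d = -1"
  shows "col (T y n) y = maj (col_before (T y n) (y - d)) (col_before (T y n) y) (col_before (T y n) (y + d))"
proof -
  have "mset_set {y - 1, y, y + 1} = {#y - 1, y, y + 1#}"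
    by simp
  then have "col (T y n) y = maj (col_before (T y n) (y - 1)) (col_before (T y n) y) (col_before (T y n) (y + 1))"
    by (simp add: col_def col_before_def update median_le_iff del: mset_set.insert)
  with assms show ?thesis
    by (auto simp: maj_def)
qed

text \<open>
  Induction over real time. Since colours are locally constant to the right, a property of the colours
  at finitely many sites cannot fail immediately after a time at which it holds, so the infimum of the
  times of failure would itself have to be a time of failure.
\<close>

lemma real_time_induct:
  assumes "finite S" "0 \<le> s"
    and start: "P s"
    and cong: "\<And>r r'. (\<And>z. z \<in> S \<Longrightarrow> col r' z = col r z) \<Longrightarrow> P r \<Longrightarrow> P r'"
    and step: "\<And>r. s < r \<Longrightarrow> (\<And>r'. s \<le> r' \<Longrightarrow> r' < r \<Longrightarrow> P r') \<Longrightarrow> P r"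
    and "s \<le> t"
  shows "P t"
proof (rule ccontr)
  assume "\<not> P t"
  define B where "B = {t. s \<le> t \<and> \<not> P t}"
  define r where "r = Inf B"
  have B: "B \<noteq> {}" "bdd_below B"
    using \<open>\<not> P t\<close> \<open>s \<le> t\<close> by (auto simp: B_def intro!: bdd_belowI[of _ s])
  have "s \<le> r"
    unfolding r_def using B by (intro cInf_greatest) (auto simp: B_def)
  have below: "P r'" if "s \<le> r'" "r' < r" for r'
    using that cInf_lower[OF _ B(2), of r'] by (force simp: B_def r_def)
  have "P r"
    using \<open>s \<le> r\<close> start step[of r] below by (cases "s = r") auto
  have "\<forall>z. \<exists>s. r < s \<and> (\<forall>n. T z n \<notin> {r<..s})"
    using ring_free_after by metis
  then obtain f where f: "\<And>z. r < f z" "\<And>z n. T z n \<notin> {r<..f z}"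
    by metis
  define b where "b = Min (insert (r + 1) (f ` S))"
  have "r < b"
    unfolding b_def using f \<open>finite S\<close> by (subst Min_gr_iff) auto
  have bf: "b \<le> f z" if "z \<in> S" for z
    unfolding b_def using that \<open>finite S\<close> by (intro Min_le) auto
  have "P r'" if "r \<le> r'" "r' < b" for r'
  proof (rule cong[OF _ \<open>P r\<close>])
    fix z assume "z \<in> S"
    have "T z n \<notin> {r<..r'}" for n
      using f(2)[where z = z and n = n] bf[OF \<open>z \<in> S\<close>] that by auto
    then show "col r' z = col r z"
      using that \<open>0 \<le> s\<close> \<open>s \<le> r\<close> by (intro constant_col) auto
  qed
  with below have "b \<le> v" if "v \<in> B" for v
    using that by (metis (mono_tags) B_def linorder_not_less mem_Collect_eq)
  then have "b \<le> Inf B"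
    using B(1) by (intro cInf_greatest)
  with \<open>r < b\<close> show False by (simp add: r_def)
qed

text \<open>
  Each of two adjacent sites of equal colour already has a majority in its neighbourhood.
\<close>

lemma equal_pair_frozen:
  assumes d: "d = 1 \<or> d = -1"
    and "0 \<le> s" "s \<le> t" "col s y = c" "col s (y + d) = c"
  shows "col t y = c \<and> col t (y + d) = c"
proof (rule real_time_induct[of "{y, y + d}" s])
  fix r r' assume "\<And>z. z \<in> {y, y + d} \<Longrightarrow> col r' z = col r z" "col r y = c \<and> col r (y + d) = c"
  then show "col r' y = c \<and> col r' (y + d) = c" by auto
next
  fix r assume "s < r"
    and IH: "\<And>r'. s \<le> r' \<Longrightarrow> r' < r \<Longrightarrow> col r' y = c \<and> col r' (y + d) = c"
  then have "0 < r" using assms by simp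
  have before: "col_before r z = c" if z: "z \<in> {y, y + d}" for z
  proof -
    have "eventually (\<lambda>r'. r' \<in> {s<..<r} \<and> col r' z = col_before r z) (at_left r)"
      using col_before_eventually[OF \<open>0 < r\<close>, of z] eventually_at_left_real[OF \<open>s < r\<close>]
      by eventually_elim auto
    then obtain r' where "r' \<in> {s<..<r}" "col r' z = col_before r z"
      using eventually_happens' trivial_limit_at_left_real by blast
    with IH[of r'] z show ?thesis by auto
  qed
  have "col r z = c" if z: "z \<in> {y, y + d}" for z
  proof (cases "\<exists>n. T z n = r")
    case True
    then obtain n where n: "T z n = r" by blast
    have "z + d \<in> {y, y + d} \<or> z - d \<in> {y, y + d}"
      using z by auto
    then show ?thesis
      using col_at_ring[OF d, of z n] before[of z] before[of "z + d"] before[of "z - d"] z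
      unfolding n by (auto simp: maj_def)
  next
    case False
    then show ?thesis
      using col_at_other_time[OF \<open>0 < r\<close>] before z by auto
  qed
  then show "col r y = c \<and> col r (y + d) = c" by auto
qed (use assms in auto)

lemma col_before_first_ring:
  assumes "0 \<le> t" "t < T y 0"
  shows "col t y = col 0 y"
proof (rule constant_col)
  show "\<forall>n. T y n \<notin> {0<..t}"
    using first_ring_le[of y] assms(2) by (meson greaterThanAtMost_iff not_le order.strict_trans2)
qed (use assms in auto)

lemma col_before_eq_initial:
  assumes "0 < s" "s \<le> T y 0"
  shows "col_before s y = col 0 y"
proof (rule constant_before)
  show "\<forall>n. T y n \<notin> {0<..<s}"
    using first_ring_le[of y] assms(2) by (meson greaterThanLessThan_iff not_le order.strict_trans2)
qed (use assms in auto)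

text \<open>
  A site that takes the majority colour of its neighbourhood agrees with one of its neighbours
  afterwards, because a majority has at least two of the three members. From then on that pair is
  frozen.
\<close>

lemma col_after_first_ring:
  assumes d: "d = 1 \<or> d = -1" and "T y 0 \<le> t"
  shows "col t y = maj (col_before (T y 0) (y - d)) (col 0 y) (col_before (T y 0) (y + d))"
proof -
  let ?s = "T y 0"
  have "0 < ?s" by (rule ring_pos)
  have at: "col ?s y = maj (col_before ?s (y - d)) (col 0 y) (col_before ?s (y + d))"
    using col_at_ring[OF d, of y 0] col_before_eq_initial[of ?s y] \<open>0 < ?s\<close> by simp
  \<comment> \<open>The neighbours do not ring at this moment, so they keep the colours that entered the majority.\<close>
  have nb: "col ?s z = col_before ?s z" if "z \<noteq> y" for z
  proof (rule col_at_other_time[OF \<open>0 < ?s\<close>])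
    show "\<forall>n. T z n \<noteq> ?s" using first_ring_alone[of y z] that by metis
  qed
  have "d \<noteq> 0" using d by auto
  then have "col ?s (y + d) = col ?s y \<or> col ?s (y + - d) = col ?s y"
    using nb[of "y + d"] nb[of "y - d"] at by (auto simp: maj_def)
  moreover have "- d = 1 \<or> - d = - 1" using d by auto
  ultimately have "col t y = col ?s y"
    using equal_pair_frozen[OF d, of ?s t y "col ?s y"]
      equal_pair_frozen[of "- d" ?s t y "col ?s y"] assms(2) \<open>0 < ?s\<close> by auto
  with at show ?thesis by simp
qed

lemma col_before_after_first_ring:
  assumes "T y 0 < s"
  shows "col_before s y = col (T y 0) y"
proof -
  let ?u = "T y 0"
  have "0 < s" using ring_pos[of y 0] assms by simp
  have "eventually (\<lambda>t. t \<in> {?u<..<s} \<and> col t y = col_before s y) (at_left s)"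
    using col_before_eventually[OF \<open>0 < s\<close>, of y] eventually_at_left_real[OF assms]
    by eventually_elim auto
  then obtain t where t: "t \<in> {?u<..<s}" "col t y = col_before s y"
    using eventually_happens' trivial_limit_at_left_real by blast
  then have "col t y = col ?u y"
    using col_after_first_ring[of 1 y t] col_after_first_ring[of 1 y ?u] by simp
  with t show ?thesis by simp
qed

text \<open>
  Seen from a site \<open>y\<close> that has not rung, the neighbour \<open>y + d\<close> either still has its initial colour
  or has taken the majority of its neighbourhood at its first ring. In the latter case it changed its
  colour, and then it agrees with \<open>y\<close>, exactly if both \<open>y\<close> and \<open>y + d + d\<close> disagreed with it.
\<close>

lemma disagreement_rec:
  assumes d: "d = 1 \<or> d = -1" and "0 < s" "s \<le> T y 0"
  shows "col_before s (y + d) \<noteq> col 0 y \<longleftrightarrow>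
    col 0 (y + d) \<noteq> col 0 y \<and>
    \<not> (T (y + d) 0 < s \<and> col_before (T (y + d) 0) (y + d + d) \<noteq> col 0 (y + d))"
proof (cases "T (y + d) 0 < s")
  case True
  let ?u = "T (y + d) 0"
  have "col_before s (y + d) = col ?u (y + d)"
    by (rule col_before_after_first_ring[OF True])
  also have "\<dots> = maj (col_before ?u y) (col 0 (y + d)) (col_before ?u (y + d + d))"
    using col_after_first_ring[OF d, of "y + d" ?u] by simp
  also have "col_before ?u y = col 0 y"
    using True assms ring_pos by (intro col_before_eq_initial) auto
  finally show ?thesis using True by (auto simp: maj_def)
next
  case False
  then show ?thesis
    using col_before_eq_initial[of s "y + d"] \<open>0 < s\<close> by auto
qed

lemma col_eq:
  assumes "0 \<le> t"
  shows "col t y \<longleftrightarrow>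
    (if T y 0 \<le> t \<and> col_before (T y 0) (y + 1) \<noteq> col 0 y \<and> col_before (T y 0) (y - 1) \<noteq> col 0 y
     then \<not> col 0 y else col 0 y)"
  using col_before_first_ring[OF assms, of y] col_after_first_ring[of 1 y t]
  by (cases "T y 0 \<le> t") (auto simp: maj_def)

end

text \<open>
  The recursion of \<open>disagreement_rec\<close>, cut off at depth \<open>n\<close>. The entry \<open>w k\<close> holds the initial
  value and the first ring time of the \<open>k\<close>-th site of a half-line, \<open>c\<close> is the colour of the site in
  front of the half-line (\<open>True\<close> if its value is at most \<open>a\<close>), and \<open>s\<close> is the time at which
  the first site of the half-line is asked whether it disagrees with \<open>c\<close>. The value at depth 0 is a
  placeholder, reached only if the first \<open>n\<close> ring times decrease, starting below \<open>s\<close>.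
\<close>

fun disagree :: "real \<Rightarrow> nat \<Rightarrow> bool \<Rightarrow> real \<Rightarrow> (nat \<Rightarrow> real \<times> real) \<Rightarrow> bool" where
  "disagree a 0 c s w \<longleftrightarrow> True"
| "disagree a (Suc n) c s w \<longleftrightarrow> (fst (w 0) \<le> a) \<noteq> c \<and>
     \<not> (snd (w 0) < s \<and> disagree a n (\<not> c) (snd (w 0)) (\<lambda>k. w (Suc k)))"

context threshold_path begin

text \<open>
  The recursion descends from a site to the next one only if the next ring time is earlier. So a site
  with a ring time of at least \<open>s\<close> stops it before or at that site, and the cut-off is not reached.
\<close>

lemma disagreement_iff_disagree:
  assumes d: "d = 1 \<or> d = -1" and "0 < s" "s \<le> T y 0"
    and "\<exists>k<n. s \<le> T (y + d * int (Suc k)) 0"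
  shows "col_before s (y + d) \<noteq> col 0 y \<longleftrightarrow>
    disagree a n (col 0 y) s (\<lambda>k. (h 0 (y + d * int (Suc k)), T (y + d * int (Suc k)) 0))"
  using assms(2-)
proof (induction n arbitrary: s y)
  case (Suc n)
  let ?z = "y + d"
  have shift: "y + d * int (Suc (Suc k)) = ?z + d * int (Suc k)" for k
    by (simp add: algebra_simps)
  have first: "y + d * int (Suc 0) = ?z"
    by simp
  show ?case
  proof (cases "T ?z 0 < s")
    case True
    obtain k where k: "k < Suc n" "s \<le> T (y + d * int (Suc k)) 0"
      using Suc.prems by blast
    with True have "k \<noteq> 0" by (cases k) auto
    then obtain j where "k = Suc j" by (cases k) auto
    have eq: "y + d * int (Suc k) = ?z + d * int (Suc j)"
      unfolding \<open>k = Suc j\<close> by (simp add: algebra_simps)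
    have "T ?z 0 \<le> T (?z + d * int (Suc j)) 0"
      using k(2) True unfolding eq by linarith
    moreover have "j < n"
      using k(1) \<open>k = Suc j\<close> by simp
    ultimately have "\<exists>k<n. T ?z 0 \<le> T (?z + d * int (Suc k)) 0"
      by blast
    from Suc.IH[of "T ?z 0" ?z, OF ring_pos _ this]
    show ?thesis
      using disagreement_rec[OF d Suc.prems(1,2)] True
      by (cases "col 0 ?z"; cases "col 0 y") (simp_all add: shift first col_def del: of_nat_Suc)
  next
    case False
    then show ?thesis
      using disagreement_rec[OF d Suc.prems(1,2)] by (auto simp: col_def)
  qed
qed auto

end

section \<open>The law of the initial values and the first ring times\<close>

definition value_law :: "real measure" where
  "value_law = uniform_measure lborel {0..1}"

definition waiting_law :: "real measure" where
  "waiting_law = density lborel (exponential_density 1)"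

definition site_law :: "(real \<times> real) measure" where
  "site_law = value_law \<Otimes>\<^sub>M waiting_law"

definition seq_law :: "(nat \<Rightarrow> real \<times> real) measure" where
  "seq_law = PiM UNIV (\<lambda>_. site_law)"

lemma sets_value_law [measurable_cong, simp]: "sets value_law = sets borel"
  by (simp add: value_law_def)

lemma space_value_law [simp]: "space value_law = UNIV"
  by (simp add: value_law_def)

lemma sets_waiting_law [measurable_cong, simp]: "sets waiting_law = sets borel"
  by (simp add: waiting_law_def)

lemma space_waiting_law [simp]: "space waiting_law = UNIV"
  by (simp add: waiting_law_def)

lemma sets_site_law [measurable_cong]: "sets site_law = sets (borel \<Otimes>\<^sub>M borel)"
  unfolding site_law_def by (intro sets_pair_measure_cong) simp_all

lemma space_site_law [simp]: "space site_law = UNIV"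
  by (simp add: site_law_def space_pair_measure)

lemma sets_seq_law [measurable_cong]: "sets seq_law = sets (PiM UNIV (\<lambda>_. borel \<Otimes>\<^sub>M borel))"
  unfolding seq_law_def by (intro sets_PiM_cong sets_site_law) simp

lemma space_seq_law [simp]: "space seq_law = UNIV"
  by (simp add: seq_law_def space_PiM)

interpretation value_law: prob_space value_law
  unfolding value_law_def by (rule prob_space_uniform_measure) auto

interpretation waiting_law: prob_space waiting_law
  unfolding waiting_law_def by (rule prob_space_exponential_density) simp

interpretation site_law: prob_space site_law
  unfolding site_law_def
  by (rule prob_space_pair) (rule value_law.prob_space_axioms waiting_law.prob_space_axioms)+

interpretation site_seq: sequence_space site_law
  by unfold_locales

interpretation seq_law: prob_space seq_law
  unfolding seq_law_def by (rule prob_space_PiM) (rule site_law.prob_space_axioms)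

lemma integral_pair_bounded:
  fixes f :: "'a \<times> 'b \<Rightarrow> real"
  assumes "prob_space A" "prob_space B"
    and "f \<in> borel_measurable (A \<Otimes>\<^sub>M B)" "\<And>p. \<bar>f p\<bar> \<le> C"
  shows "(\<integral>p. f p \<partial>(A \<Otimes>\<^sub>M B)) = (\<integral>x. \<integral>y. f (x, y) \<partial>B \<partial>A)"
proof -
  interpret A: prob_space A by fact
  interpret B: prob_space B by fact
  interpret AB: pair_prob_space A B ..
  have "integrable (A \<Otimes>\<^sub>M B) f"
    using assms by (intro AB.P.integrable_const_bound[of f C]) auto
  then show ?thesis
    by (simp add: AB.integral_fst')
qed

lemma AE_waiting_law_nonneg: "AE u in waiting_law. 0 \<le> u"
  unfolding waiting_law_def
  by (subst AE_density) (auto simp: exponential_density_def)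

lemma AE_waiting_law_neq: "AE u in waiting_law. u \<noteq> s"
  unfolding waiting_law_def
  using AE_lborel_singleton[of s] by (subst AE_density) auto

lemma integral_waiting_law:
  assumes "0 \<le> s"
    and deriv: "\<And>u. 0 \<le> u \<Longrightarrow> u \<le> s \<Longrightarrow> (G has_real_derivative exp (- u) * g u) (at u)"
    and cont: "\<And>u. 0 \<le> u \<Longrightarrow> u \<le> s \<Longrightarrow> isCont g u"
    and g: "g \<in> borel_measurable borel"
  shows "(\<integral>u. of_bool (u < s) * g u \<partial>waiting_law) = G s - G 0"
proof -
  have "(\<integral>u. of_bool (u < s) * g u \<partial>waiting_law) =
      (\<integral>u. exponential_density 1 u * (of_bool (u < s) * g u) \<partial>lborel)"
    unfolding waiting_law_def using g
    by (subst integral_real_density) (auto simp: exponential_density_nonneg of_bool_def)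
  also have "\<dots> = (\<integral>u. (exp (- u) * g u) * indicator {0..s} u \<partial>lborel)"
  proof (rule integral_cong_AE)
    show "AE u in lborel. exponential_density 1 u * (of_bool (u < s) * g u) =
        exp (- u) * g u * indicator {0..s} u"
      using AE_lborel_singleton[of s]
      by eventually_elim (auto simp: exponential_density_def indicator_def)
  qed (use g in \<open>simp_all add: of_bool_def\<close>)
  also have "\<dots> = G s - G 0"
    using assms by (intro integral_FTC_Icc_real continuous_intros) auto
  finally show ?thesis .
qed

section \<open>The probability of disagreement at finite depth\<close>

definition prob_neq_colour :: "real \<Rightarrow> bool \<Rightarrow> real" where
  "prob_neq_colour a c = (if c then 1 - a else a)"

lemma prob_colour:
  assumes "a \<in> {0..1}"
  shows "(\<integral>v. of_bool ((v \<le> a) = c) \<partial>value_law) = prob_neq_colour a (\<not> c)"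
proof -
  have le: "measure value_law {..a} = a"
  proof -
    have "{0..1} \<inter> {..a} = {0..a}" using assms by auto
    then show ?thesis
      unfolding value_law_def using assms by (subst measure_uniform_measure) auto
  qed
  have gt: "measure value_law {a<..} = 1 - a"
    using value_law.prob_compl[of "{..a}"] le by (simp add: Compl_atMost flip: Compl_eq_Diff_UNIV)
  have "(\<integral>v. of_bool ((v \<le> a) = c) \<partial>value_law) =
      (\<integral>v. indicator (if c then {..a} else {a<..}) v \<partial>value_law)"
    by (intro Bochner_Integration.integral_cong) (auto simp: indicator_def)
  also have "\<dots> = prob_neq_colour a (\<not> c)"
    using le gt by (simp add: prob_neq_colour_def)
  finally show ?thesis .
qed

lemma measurable_disagree [measurable (raw)]:
  assumes [measurable]: "f \<in> borel_measurable L" "g \<in> L \<rightarrow>\<^sub>M PiM UNIV (\<lambda>_. borel \<Otimes>\<^sub>M borel)"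
  shows "Measurable.pred L (\<lambda>x. disagree a n c (f x) (g x))"
  using assms
proof (induction n arbitrary: c f g)
  case (Suc n)
  note [measurable] = Suc.prems
  have [measurable]: "(\<lambda>x. g x k) \<in> L \<rightarrow>\<^sub>M borel \<Otimes>\<^sub>M borel" for k
    by measurable
  have [measurable]: "(\<lambda>x k. g x (Suc k)) \<in> L \<rightarrow>\<^sub>M PiM UNIV (\<lambda>_. borel \<Otimes>\<^sub>M borel)"
    by (rule measurable_PiM_single') (auto simp: space_pair_measure)
  have [measurable]: "Measurable.pred L (\<lambda>x. disagree a n (\<not> c) (snd (g x 0)) (\<lambda>k. g x (Suc k)))"
    by (rule Suc.IH) measurable
  show ?case
    by simp
qed simp

definition disagree_prob :: "real \<Rightarrow> nat \<Rightarrow> bool \<Rightarrow> real \<Rightarrow> real" where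
  "disagree_prob a n c s = (\<integral>w. of_bool (disagree a n c s w) \<partial>seq_law)"

lemma measurable_disagree_prob [measurable]: "disagree_prob a n c \<in> borel_measurable borel"
  unfolding disagree_prob_def
  by (rule seq_law.borel_measurable_lebesgue_integral) (simp add: split_beta of_bool_def)

lemma disagree_prob_bounds: "0 \<le> disagree_prob a n c s" "disagree_prob a n c s \<le> 1"
proof -
  show "0 \<le> disagree_prob a n c s"
    unfolding disagree_prob_def by (intro Bochner_Integration.integral_nonneg) auto
  have "disagree_prob a n c s \<le> (\<integral>w. 1 \<partial>seq_law)"
    unfolding disagree_prob_def
    by (intro integral_mono seq_law.integrable_const_bound[of _ 1]) (auto simp: of_bool_def)
  then show "disagree_prob a n c s \<le> 1"
    using seq_law.prob_space by simp
qed

lemma disagree_prob_0 [simp]: "disagree_prob a 0 c s = 1"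
  unfolding disagree_prob_def using seq_law.prob_space by simp

text \<open>
  The first site of a half-line is independent of the remaining ones, which form a half-line of the
  same law (\<open>site_seq.PiM_iter\<close>), so the recursion passes to the probabilities by Fubini.
\<close>

lemma disagree_prob_Suc:
  assumes "a \<in> {0..1}"
  shows "disagree_prob a (Suc n) c s =
    prob_neq_colour a c * (1 - (\<integral>u. of_bool (u < s) * disagree_prob a n (\<not> c) u \<partial>waiting_law))"
proof -
  let ?F = "\<lambda>w. of_bool (disagree a (Suc n) c s w) :: real"
  let ?q = "disagree_prob a n (\<not> c)"
  have F: "?F \<in> borel_measurable seq_law"
    by (simp add: of_bool_def del: disagree.simps)
  have "disagree_prob a (Suc n) c s = (\<integral>w. ?F w \<partial>distr (site_law \<Otimes>\<^sub>M seq_law) seq_law (\<lambda>(p, w). case_nat p w))"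
    unfolding disagree_prob_def seq_law_def site_seq.PiM_iter ..
  also have "\<dots> = (\<integral>x. ?F ((\<lambda>(p, w). case_nat p w) x) \<partial>(site_law \<Otimes>\<^sub>M seq_law))"
    by (rule integral_distr[OF _ F]) (unfold seq_law_def, measurable)
  also have "\<dots> = (\<integral>p. \<integral>w. ?F (case_nat p w) \<partial>seq_law \<partial>site_law)"
  proof (subst integral_pair_bounded[where C = 1])
    show "(\<lambda>x. ?F ((\<lambda>(p, w). case_nat p w) x)) \<in> borel_measurable (site_law \<Otimes>\<^sub>M seq_law)"
      by (rule measurable_compose[OF _ F]) (unfold seq_law_def, measurable)
  qed (simp_all add: site_law.prob_space_axioms seq_law.prob_space_axioms del: disagree.simps)
  also have "\<dots> = (\<integral>p. of_bool ((fst p \<le> a) = (\<not> c)) * (1 - of_bool (snd p < s) * ?q (snd p)) \<partial>site_law)"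
  proof (rule Bochner_Integration.integral_cong[OF refl])
    fix p :: "real \<times> real"
    have int: "integrable seq_law (\<lambda>w. of_bool (disagree a n (\<not> c) (snd p) w) :: real)"
      by (intro seq_law.integrable_const_bound[of _ 1]) (auto simp: of_bool_def)
    have "(\<integral>w. ?F (case_nat p w) \<partial>seq_law) = (\<integral>w. of_bool ((fst p \<le> a) = (\<not> c)) *
        (1 - of_bool (snd p < s) * of_bool (disagree a n (\<not> c) (snd p) w)) \<partial>seq_law)"
      by (intro Bochner_Integration.integral_cong) (auto simp: of_bool_def)
    also have "\<dots> = of_bool ((fst p \<le> a) = (\<not> c)) * (1 - of_bool (snd p < s) * ?q (snd p))"
      using int seq_law.prob_space by (simp add: disagree_prob_def)
    finally show "(\<integral>w. ?F (case_nat p w) \<partial>seq_law) =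
        of_bool ((fst p \<le> a) = (\<not> c)) * (1 - of_bool (snd p < s) * ?q (snd p))" .
  qed
  also have "\<dots> = (\<integral>v. \<integral>u. of_bool ((v \<le> a) = (\<not> c)) * (1 - of_bool (u < s) * ?q u) \<partial>waiting_law \<partial>value_law)"
    unfolding site_law_def
    using disagree_prob_bounds[of a n "\<not> c"]
    by (subst integral_pair_bounded[where C = 1])
       (auto simp: value_law.prob_space_axioms waiting_law.prob_space_axioms of_bool_def abs_le_iff
             intro: order_trans[OF _ zero_le_one])
  also have "\<dots> = prob_neq_colour a c * (1 - (\<integral>u. of_bool (u < s) * ?q u \<partial>waiting_law))"
  proof -
    have "integrable waiting_law (\<lambda>u. of_bool (u < s) * ?q u)"
      using disagree_prob_bounds[of a n "\<not> c"]
      by (intro waiting_law.integrable_const_bound[of _ 1]) (auto simp: of_bool_def)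
    then show ?thesis
      using prob_colour[OF assms, of "\<not> c"] waiting_law.prob_space by simp
  qed
  finally show ?thesis .
qed

section \<open>The limit of infinite depth\<close>

text \<open>
  With \<open>\<tau> = 1 - exp (- s)\<close> and \<open>b = prob_neq_colour a\<close> the limit solves the linear system
  \<open>dF c / d\<tau> = - b c * F (\<not> c)\<close>, \<open>F c = b c\<close> at \<open>\<tau> = 0\<close>. As \<open>b True * b False = a * (1 - a)\<close>, the
  characteristic exponents are \<open>sqrt (a * (1 - a))\<close> and its negative.
\<close>

definition disagree_limit :: "real \<Rightarrow> bool \<Rightarrow> real \<Rightarrow> real" where
  "disagree_limit a c s = (let k = sqrt (a * (1 - a)); \<tau> = 1 - exp (- s)
     in prob_neq_colour a c * cosh (k * \<tau>) - k * sinh (k * \<tau>))"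

lemma prob_neq_colour_bounds: "a \<in> {0..1} \<Longrightarrow> 0 \<le> prob_neq_colour a c \<and> prob_neq_colour a c \<le> 1"
  by (simp add: prob_neq_colour_def)

lemma prob_neq_colour_mult: "prob_neq_colour a c * prob_neq_colour a (\<not> c) = a * (1 - a)"
  by (simp add: prob_neq_colour_def)

lemma disagree_limit_deriv:
  assumes "a \<in> {0..1}"
  shows "(disagree_limit a c has_real_derivative exp (- s) * (- prob_neq_colour a c * disagree_limit a (\<not> c) s)) (at s)"
proof -
  define k where "k = sqrt (a * (1 - a))"
  have k: "k * k = prob_neq_colour a c * prob_neq_colour a (\<not> c)"
    using assms by (simp add: k_def prob_neq_colour_mult)
  have "((\<lambda>s. prob_neq_colour a c * cosh (k * (1 - exp (- s))) - k * sinh (k * (1 - exp (- s)))) has_real_derivative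
      (prob_neq_colour a c * (sinh (k * (1 - exp (- s))) * (k * exp (- s)))
        - k * (cosh (k * (1 - exp (- s))) * (k * exp (- s))))) (at s)"
    by (auto intro!: derivative_eq_intros)
  also have "prob_neq_colour a c * (sinh (k * (1 - exp (- s))) * (k * exp (- s)))
        - k * (cosh (k * (1 - exp (- s))) * (k * exp (- s))) =
      exp (- s) * (prob_neq_colour a c * k * sinh (k * (1 - exp (- s))) - (k * k) * cosh (k * (1 - exp (- s))))"
    by (simp add: algebra_simps)
  also have "\<dots> = exp (- s) * (- prob_neq_colour a c * disagree_limit a (\<not> c) s)"
    unfolding k disagree_limit_def Let_def k_def[symmetric] by (simp add: algebra_simps)
  finally show ?thesis
    by (simp add: disagree_limit_def[abs_def] Let_def k_def)
qed

lemma isCont_disagree_limit: "isCont (disagree_limit a c) s"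
  unfolding disagree_limit_def[abs_def] Let_def by (intro continuous_intros)

lemma measurable_disagree_limit [measurable]: "disagree_limit a c \<in> borel_measurable borel"
  by (intro borel_measurable_continuous_onI) (simp add: continuous_at_imp_continuous_on isCont_disagree_limit)

lemma disagree_limit_integral_eq:
  assumes "a \<in> {0..1}" "0 \<le> s"
  shows "disagree_limit a c s = prob_neq_colour a c * (1 - (\<integral>u. of_bool (u < s) * disagree_limit a (\<not> c) u \<partial>waiting_law))"
proof -
  have "(\<integral>u. of_bool (u < s) * (- prob_neq_colour a c * disagree_limit a (\<not> c) u) \<partial>waiting_law) = disagree_limit a c s - disagree_limit a c 0"
    using assms isCont_disagree_limit
    by (intro integral_waiting_law disagree_limit_deriv continuous_intros) auto
  moreover have "(\<integral>u. of_bool (u < s) * (- prob_neq_colour a c * disagree_limit a (\<not> c) u) \<partial>waiting_law) =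
      - prob_neq_colour a c * (\<integral>u. of_bool (u < s) * disagree_limit a (\<not> c) u \<partial>waiting_law)"
    by (subst integral_mult_right_zero[symmetric]) (simp add: mult_ac)
  moreover have "disagree_limit a c 0 = prob_neq_colour a c"
    by (simp add: disagree_limit_def)
  ultimately show ?thesis
    by (simp add: algebra_simps)
qed

lemma disagree_limit_bound:
  assumes "a \<in> {0..1}" "0 \<le> s"
  shows "\<bar>disagree_limit a c s\<bar> \<le> cosh 1 + sinh 1"
proof -
  define k where "k = sqrt (a * (1 - a))"
  have "a * (1 - a) \<le> 1"
    using assms by (intro mult_le_one) auto
  then have k: "0 \<le> k" "k \<le> 1"
    using assms by (auto simp: k_def)
  define z where "z = k * (1 - exp (- s))"
  have z: "0 \<le> z" "z \<le> 1"
    unfolding z_def using k assms by (auto intro!: mult_nonneg_nonneg mult_le_one)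
  have "\<bar>prob_neq_colour a c * cosh z\<bar> \<le> 1 * cosh 1"
    unfolding abs_mult using prob_neq_colour_bounds[OF assms(1), of c] z by (intro mult_mono) (auto simp: cosh_real_nonneg_le_iff)
  moreover have "\<bar>k * sinh z\<bar> \<le> 1 * sinh 1"
    unfolding abs_mult using k z by (intro mult_mono) auto
  ultimately show ?thesis
    unfolding disagree_limit_def Let_def k_def[symmetric] z_def[symmetric] by linarith
qed

text \<open>
  The recursion step multiplies the error by a factor below 1 and integrates it, and integrating
  \<open>(1 - exp (- u)) ^ n\<close> against the exponential density raises the power.
\<close>

lemma disagree_prob_minus_lim:
  assumes a: "a \<in> {0..1}" and "0 \<le> s"
  shows "\<bar>disagree_prob a n c s - disagree_limit a c s\<bar> \<le> (1 + cosh 1 + sinh 1) * (1 - exp (- s)) ^ n"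
  using \<open>0 \<le> s\<close>
proof (induction n arbitrary: c s)
  case 0
  then show ?case
    using disagree_limit_bound[OF a, of s c] by simp
next
  case (Suc n)
  define K where "K = (1 + cosh 1 + sinh 1 :: real)"
  have "0 \<le> K" by (simp add: K_def)
  let ?p = "\<lambda>u. of_bool (u < s) * disagree_prob a n (\<not> c) u"
  let ?l = "\<lambda>u. of_bool (u < s) * disagree_limit a (\<not> c) u"
  let ?b = "\<lambda>u. of_bool (u < s) * (K * (1 - exp (- u)) ^ n)"
  have p: "integrable waiting_law ?p"
    using disagree_prob_bounds[of a n "\<not> c"]
    by (intro waiting_law.integrable_const_bound[of _ 1]) (auto simp: of_bool_def)
  have l: "integrable waiting_law ?l"
  proof (rule waiting_law.integrable_const_bound)
    show "AE u in waiting_law. norm (?l u) \<le> cosh 1 + sinh 1"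
      using AE_waiting_law_nonneg
      by eventually_elim (use disagree_limit_bound[OF a, of _ "\<not> c"] in \<open>auto simp: of_bool_def\<close>)
  qed (simp add: of_bool_def)
  have b: "integrable waiting_law ?b"
  proof (rule waiting_law.integrable_const_bound)
    show "AE u in waiting_law. norm (?b u) \<le> K"
      using AE_waiting_law_nonneg
    proof eventually_elim
      case (elim u)
      then have "(1 - exp (- u)) ^ n \<le> 1" "0 \<le> (1 - exp (- u)) ^ n"
        by (auto intro!: power_le_one)
      then show ?case
        using \<open>0 \<le> K\<close> by (auto simp: of_bool_def mult_left_le)
    qed
  qed (simp add: of_bool_def)
  have "\<bar>disagree_prob a (Suc n) c s - disagree_limit a c s\<bar> = prob_neq_colour a c * \<bar>\<integral>u. ?p u - ?l u \<partial>waiting_law\<bar>"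
  proof -
    have "disagree_prob a (Suc n) c s - disagree_limit a c s = - prob_neq_colour a c * (\<integral>u. ?p u - ?l u \<partial>waiting_law)"
      unfolding disagree_prob_Suc[OF a] disagree_limit_integral_eq[OF a Suc.prems] Bochner_Integration.integral_diff[OF p l]
      by (simp add: algebra_simps)
    then show ?thesis
      using prob_neq_colour_bounds[OF a, of c] by (simp add: abs_mult)
  qed
  also have "\<dots> \<le> 1 * (\<integral>u. ?b u \<partial>waiting_law)"
  proof (rule mult_mono)
    have "\<bar>\<integral>u. ?p u - ?l u \<partial>waiting_law\<bar> \<le> (\<integral>u. \<bar>?p u - ?l u\<bar> \<partial>waiting_law)"
      by (rule integral_abs_bound)
    also have "\<dots> \<le> (\<integral>u. ?b u \<partial>waiting_law)"
    proof (rule integral_mono_AE)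
      show "AE u in waiting_law. \<bar>?p u - ?l u\<bar> \<le> ?b u"
        using AE_waiting_law_nonneg
        by eventually_elim (use Suc.IH[of _ "\<not> c"] in \<open>auto simp: of_bool_def K_def\<close>)
    qed (use p l b in auto)
    finally show "\<bar>\<integral>u. ?p u - ?l u \<partial>waiting_law\<bar> \<le> (\<integral>u. ?b u \<partial>waiting_law)" .
  qed (use prob_neq_colour_bounds[OF a, of c] in auto)
  also have "(\<integral>u. ?b u \<partial>waiting_law) = K * (1 - exp (- s)) ^ Suc n / real (Suc n) - K * (1 - exp (- 0)) ^ Suc n / real (Suc n)"
    using \<open>0 \<le> s\<close>
    by (intro integral_waiting_law[where G = "\<lambda>u. K * (1 - exp (- u)) ^ Suc n / real (Suc n)"])
       (auto intro!: derivative_eq_intros continuous_intros simp del: power_Suc of_nat_Suc simp: field_simps)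
  also have "\<dots> \<le> K * (1 - exp (- s)) ^ Suc n / 1"
    using \<open>0 \<le> K\<close> \<open>0 \<le> s\<close>
    by (simp del: power_Suc of_nat_Suc) (intro divide_left_mono[where c = "_ :: real" and b = 1, simplified] mult_nonneg_nonneg zero_le_power; simp)
  finally show ?case
    by (simp add: K_def del: power_Suc)
qed

lemma disagree_prob_tendsto:
  assumes "a \<in> {0..1}" "0 \<le> s"
  shows "(\<lambda>n. disagree_prob a n c s) \<longlonglongrightarrow> disagree_limit a c s"
proof (rule Lim_null[THEN iffD2], rule Lim_null_comparison)
  show "\<forall>\<^sub>F n in sequentially. norm (disagree_prob a n c s - disagree_limit a c s) \<le> (1 + cosh 1 + sinh 1) * (1 - exp (- s)) ^ n"
    using disagree_prob_minus_lim[OF assms] by simp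
  have "(\<lambda>n. (1 - exp (- s)) ^ n) \<longlonglongrightarrow> 0"
    using assms by (intro LIMSEQ_realpow_zero) auto
  then show "(\<lambda>n. (1 + cosh 1 + sinh 1) * (1 - exp (- s)) ^ n) \<longlonglongrightarrow> 0"
    by (rule tendsto_mult_right_zero)
qed

text \<open>
  The conservation law. The derivative of the left-hand side with respect to \<open>\<tau>\<close> vanishes, because
  both terms contribute \<open>2 * a * (1 - a) * F True * F False\<close> with opposite signs. With the closed form
  it is an instance of \<open>cosh\<^sup>2 - sinh\<^sup>2 = 1\<close>.
\<close>

lemma disagree_limit_conserved:
  assumes "a \<in> {0..1}"
  shows "prob_neq_colour a False * (disagree_limit a True s)\<^sup>2 - prob_neq_colour a True * (disagree_limit a False s)\<^sup>2 = a * (1 - a) * (1 - 2 * a)"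
proof -
  define k where "k = sqrt (a * (1 - a))"
  have k: "k\<^sup>2 = a * (1 - a)"
    using assms by (simp add: k_def)
  define C S where "C = cosh (k * (1 - exp (- s)))" and "S = sinh (k * (1 - exp (- s)))"
  have CS: "C\<^sup>2 = S\<^sup>2 + 1"
    by (simp add: C_def S_def cosh_square_eq)
  have "a * ((1 - a) * C - k * S)\<^sup>2 - (1 - a) * (a * C - k * S)\<^sup>2 =
      (1 - 2 * a) * (a * (1 - a) * C\<^sup>2 - k\<^sup>2 * S\<^sup>2)"
    by (simp add: power2_eq_square algebra_simps)
  also have "\<dots> = a * (1 - a) * (1 - 2 * a)"
    unfolding k CS by (simp add: algebra_simps)
  finally show ?thesis
    by (simp add: prob_neq_colour_def disagree_limit_def Let_def C_def S_def k_def)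
qed

section \<open>The imbalance of the two kinds of colour changes\<close>

text \<open>
  The event that a site of initial colour \<open>c\<close> changes its colour by time \<open>t\<close>, with the recursion cut off at
  depth \<open>n\<close>. The arguments are the value and the first ring time of the site, and the data of the two
  half-lines next to it.
\<close>

definition flips :: "real \<Rightarrow> nat \<Rightarrow> real \<Rightarrow> bool \<Rightarrow>
    (real \<times> real) \<times> (nat \<Rightarrow> real \<times> real) \<times> (nat \<Rightarrow> real \<times> real) \<Rightarrow> bool" where
  "flips a n t c = (\<lambda>((v, u), l, r). u \<le> t \<and> (v \<le> a) = c \<and> disagree a n c u l \<and> disagree a n c u r)"

abbreviation window_law where
  "window_law \<equiv> site_law \<Otimes>\<^sub>M seq_law \<Otimes>\<^sub>M seq_law"

lemma measurable_flip [measurable]: "Measurable.pred window_law (flips a n t c)"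
  unfolding flips_def split_beta by simp

text \<open>
  Given the value and the ring time \<open>u\<close> of the site, the two half-lines disagree with it
  independently, which accounts for the square.
\<close>

lemma flip_prob:
  assumes a: "a \<in> {0..1}"
  shows "(\<integral>x. of_bool (flips a n t c x) \<partial>window_law) =
    prob_neq_colour a (\<not> c) * (\<integral>u. of_bool (u \<le> t) * (disagree_prob a n c u)\<^sup>2 \<partial>waiting_law)"
proof -
  have pp: "prob_space (seq_law \<Otimes>\<^sub>M seq_law)"
    by (intro prob_space_pair seq_law.prob_space_axioms)
  have two: "(\<integral>x. of_bool (disagree a n c u (fst x) \<and> disagree a n c u (snd x)) \<partial>(seq_law \<Otimes>\<^sub>M seq_law)) = (disagree_prob a n c u)\<^sup>2" for u
  proof -
    have "(\<integral>x. of_bool (disagree a n c u (fst x) \<and> disagree a n c u (snd x)) \<partial>(seq_law \<Otimes>\<^sub>M seq_law)) =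
       (\<integral>l. \<integral>r. (of_bool (disagree a n c u l) * of_bool (disagree a n c u r) :: real) \<partial>seq_law \<partial>seq_law)"
      by (rule trans[OF integral_pair_bounded[where C = 1]])
        (auto simp: seq_law.prob_space_axioms of_bool_conj)
    then show ?thesis
      by (simp add: disagree_prob_def power2_eq_square)
  qed
  have "(\<integral>x. of_bool (flips a n t c x) \<partial>window_law) =
    (\<integral>p. \<integral>x. (of_bool (flips a n t c (p, x)) :: real) \<partial>(seq_law \<Otimes>\<^sub>M seq_law) \<partial>site_law)"
    using measurable_flip[of a n t c]
    by (intro integral_pair_bounded[where C = 1] pp site_law.prob_space_axioms) (auto simp: of_bool_def)
  also have "\<dots> = (\<integral>p. of_bool ((fst p \<le> a) = c) * (of_bool (snd p \<le> t) * (disagree_prob a n c (snd p))\<^sup>2) \<partial>site_law)"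
  proof (rule Bochner_Integration.integral_cong[OF refl])
    fix p :: "real \<times> real"
    have "(\<integral>x. (of_bool (flips a n t c (p, x)) :: real) \<partial>(seq_law \<Otimes>\<^sub>M seq_law)) =
      (\<integral>x. of_bool ((fst p \<le> a) = c) * (of_bool (snd p \<le> t) *
         of_bool (disagree a n c (snd p) (fst x) \<and> disagree a n c (snd p) (snd x))) \<partial>(seq_law \<Otimes>\<^sub>M seq_law))"
      by (intro Bochner_Integration.integral_cong) (auto simp: flips_def split_beta)
    then show "(\<integral>x. of_bool (flips a n t c (p, x)) \<partial>(seq_law \<Otimes>\<^sub>M seq_law)) =
      of_bool ((fst p \<le> a) = c) * (of_bool (snd p \<le> t) * (disagree_prob a n c (snd p))\<^sup>2)"
      by (simp add: two)
  qed
  also have "\<dots> = (\<integral>v. \<integral>u. of_bool ((v \<le> a) = c) * (of_bool (u \<le> t) * (disagree_prob a n c u)\<^sup>2) \<partial>waiting_law \<partial>value_law)"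
    unfolding site_law_def
    using disagree_prob_bounds[of a n c]
    by (subst integral_pair_bounded[where C = 1])
       (auto simp: value_law.prob_space_axioms waiting_law.prob_space_axioms of_bool_def power_le_one)
  also have "\<dots> = prob_neq_colour a (\<not> c) * (\<integral>u. of_bool (u \<le> t) * (disagree_prob a n c u)\<^sup>2 \<partial>waiting_law)"
    using prob_colour[OF a, of c] by simp
  finally show ?thesis .
qed

lemma flip_prob_tendsto:
  assumes a: "a \<in> {0..1}"
  shows "(\<lambda>n. \<integral>x. of_bool (flips a n t c x) \<partial>window_law) \<longlonglongrightarrow>
    prob_neq_colour a (\<not> c) * (\<integral>u. of_bool (u \<le> t) * (disagree_limit a c u)\<^sup>2 \<partial>waiting_law)"
  unfolding flip_prob[OF a]
proof (intro tendsto_mult_left integral_dominated_convergence[where w = "\<lambda>_. 1"])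
  show "AE u in waiting_law. (\<lambda>n. of_bool (u \<le> t) * (disagree_prob a n c u)\<^sup>2) \<longlonglongrightarrow> of_bool (u \<le> t) * (disagree_limit a c u)\<^sup>2"
    using AE_waiting_law_nonneg
    by eventually_elim (intro tendsto_intros disagree_prob_tendsto[OF a])
  show "AE u in waiting_law. norm (of_bool (u \<le> t) * (disagree_prob a n c u)\<^sup>2) \<le> 1" for n
    using disagree_prob_bounds[of a n c] by (auto simp: of_bool_def power_le_one)
qed (auto simp: of_bool_def)

lemma flip_imbalance_tendsto:
  assumes a: "a \<in> {0..1}" and "0 \<le> t"
  shows "(\<lambda>n. (\<integral>x. of_bool (flips a n t True x) \<partial>window_law) - (\<integral>x. of_bool (flips a n t False x) \<partial>window_law))
    \<longlonglongrightarrow> (1 - exp (- t)) * (a * (1 - a) * (1 - 2 * a))"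
proof -
  have int: "integrable waiting_law (\<lambda>u. of_bool (u \<le> t) * (disagree_limit a c u)\<^sup>2)" for c
  proof (rule waiting_law.integrable_const_bound)
    show "AE u in waiting_law. norm (of_bool (u \<le> t) * (disagree_limit a c u)\<^sup>2) \<le> (cosh 1 + sinh 1)\<^sup>2"
      using AE_waiting_law_nonneg
    proof eventually_elim
      case (elim u)
      then have "(disagree_limit a c u)\<^sup>2 \<le> (cosh 1 + sinh 1)\<^sup>2"
        using disagree_limit_bound[OF a elim, of c] by (intro power2_le_iff_abs_le[THEN iffD2]) auto
      then show ?case by (auto simp: of_bool_def)
    qed
  qed (simp add: of_bool_def)
  have "prob_neq_colour a False * (\<integral>u. of_bool (u \<le> t) * (disagree_limit a True u)\<^sup>2 \<partial>waiting_law) -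
      prob_neq_colour a True * (\<integral>u. of_bool (u \<le> t) * (disagree_limit a False u)\<^sup>2 \<partial>waiting_law) =
    (\<integral>u. prob_neq_colour a False * (of_bool (u \<le> t) * (disagree_limit a True u)\<^sup>2) -
      prob_neq_colour a True * (of_bool (u \<le> t) * (disagree_limit a False u)\<^sup>2) \<partial>waiting_law)"
    using int by simp
  also have "\<dots> = (\<integral>u. of_bool (u < t) * (a * (1 - a) * (1 - 2 * a)) \<partial>waiting_law)"
  proof (rule integral_cong_AE)
    show "AE u in waiting_law. prob_neq_colour a False * (of_bool (u \<le> t) * (disagree_limit a True u)\<^sup>2) -
      prob_neq_colour a True * (of_bool (u \<le> t) * (disagree_limit a False u)\<^sup>2) = of_bool (u < t) * (a * (1 - a) * (1 - 2 * a))"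
      using AE_waiting_law_neq[of t]
      by eventually_elim (use disagree_limit_conserved[OF a] in \<open>auto simp: of_bool_def\<close>)
  qed (simp_all add: of_bool_def)
  also have "\<dots> = (1 - exp (- t)) * (a * (1 - a) * (1 - 2 * a)) - (1 - exp (- 0)) * (a * (1 - a) * (1 - 2 * a))"
    using \<open>0 \<le> t\<close> by (intro integral_waiting_law) (auto intro!: derivative_eq_intros)
  finally show ?thesis
    using tendsto_diff[OF flip_prob_tendsto[OF a, of t True] flip_prob_tendsto[OF a, of t False]] by simp
qed

section \<open>The probability space of the dynamics\<close>

text \<open>
  Independence of functions of disjoint blocks, stated in terms of laws so that the two functions may
  take values in different types, as a single site and a pair of half-lines do.
\<close>

lemma (in prob_space) distr_pair_blocks:
  assumes ind: "indep_vars (\<lambda>_. N) X I" and AB: "A \<inter> B = {}" "A \<subseteq> I" "B \<subseteq> I"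
    and f: "f \<in> PiM A (\<lambda>_. N) \<rightarrow>\<^sub>M P" and g: "g \<in> PiM B (\<lambda>_. N) \<rightarrow>\<^sub>M Q"
    and F: "\<And>\<omega>. F \<omega> = f (\<lambda>i\<in>A. X i \<omega>)" and G: "\<And>\<omega>. G \<omega> = g (\<lambda>i\<in>B. X i \<omega>)"
  shows "distr M (P \<Otimes>\<^sub>M Q) (\<lambda>\<omega>. (F \<omega>, G \<omega>)) = distr M P F \<Otimes>\<^sub>M distr M Q G"
proof -
  let ?A = "PiM A (\<lambda>_. N)" and ?B = "PiM B (\<lambda>_. N)"
  let ?X = "\<lambda>\<omega>. \<lambda>i\<in>A. X i \<omega>" and ?Y = "\<lambda>\<omega>. \<lambda>i\<in>B. X i \<omega>"
  have X: "?X \<in> M \<rightarrow>\<^sub>M ?A" and Y: "?Y \<in> M \<rightarrow>\<^sub>M ?B"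
    and XY: "distr M ?A ?X \<Otimes>\<^sub>M distr M ?B ?Y = distr M (?A \<Otimes>\<^sub>M ?B) (\<lambda>\<omega>. (?X \<omega>, ?Y \<omega>))"
    using indep_var_restrict[OF ind AB] unfolding indep_var_distribution_eq by auto
  interpret gY: prob_space "distr M Q (\<lambda>\<omega>. g (?Y \<omega>))"
    by (rule prob_space_distr) (rule measurable_compose[OF Y g])
  have fX: "distr M P (\<lambda>\<omega>. f (?X \<omega>)) = distr (distr M ?A ?X) P f"
    and gY: "distr M Q (\<lambda>\<omega>. g (?Y \<omega>)) = distr (distr M ?B ?Y) Q g"
    using X Y f g by (auto simp: distr_distr comp_def)
  have "distr M P (\<lambda>\<omega>. f (?X \<omega>)) \<Otimes>\<^sub>M distr M Q (\<lambda>\<omega>. g (?Y \<omega>)) =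
      distr (distr M ?A ?X \<Otimes>\<^sub>M distr M ?B ?Y) (P \<Otimes>\<^sub>M Q) (\<lambda>(x, y). (f x, g y))"
    unfolding fX gY
  proof (rule pair_measure_distr)
    show "sigma_finite_measure (distr (distr M ?B ?Y) Q g)"
      unfolding gY[symmetric] by unfold_locales
  qed (use f g in simp_all)
  also have "\<dots> = distr M (P \<Otimes>\<^sub>M Q) ((\<lambda>(x, y). (f x, g y)) \<circ> (\<lambda>\<omega>. (?X \<omega>, ?Y \<omega>)))"
    unfolding XY
  proof (rule distr_distr)
    show "(\<lambda>(x, y). (f x, g y)) \<in> ?A \<Otimes>\<^sub>M ?B \<rightarrow>\<^sub>M P \<Otimes>\<^sub>M Q"
      using f g by measurable
    show "(\<lambda>\<omega>. (?X \<omega>, ?Y \<omega>)) \<in> M \<rightarrow>\<^sub>M ?A \<Otimes>\<^sub>M ?B"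
      using X Y by (rule measurable_Pair)
  qed
  finally show ?thesis
    by (simp add: comp_def F[abs_def] G[abs_def])
qed

locale int_median_dynamics = median_dynamics M int_adj T \<eta>
  for M :: "'w measure" and T :: "int \<Rightarrow> nat \<Rightarrow> 'w \<Rightarrow> real" and \<eta> :: "real \<Rightarrow> int \<Rightarrow> 'w \<Rightarrow> real"
begin

abbreviation wait :: "int \<Rightarrow> nat \<Rightarrow> 'w \<Rightarrow> real" where
  "wait y \<equiv> waiting_time (T y)"

definition input :: "int + int \<times> nat \<Rightarrow> 'w \<Rightarrow> real" where
  "input = case_sum (\<lambda>y. \<eta> 0 y) (\<lambda>(y, n). wait y n)"

lemma input_simps [simp]: "input (Inl y) = \<eta> 0 y" "input (Inr (y, n)) = wait y n"
  by (auto simp: input_def)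

lemma indep_input: "indep_vars (\<lambda>_. borel) input UNIV"
  using independent unfolding input_def .

lemma measurable_wait [measurable]: "wait y n \<in> borel_measurable M"
  using distributed_measurable[OF waiting_exponential[of y n]] by simp

lemma measurable_initial [measurable]: "\<eta> 0 y \<in> borel_measurable M"
  by (rule measurable_value) simp

lemma distr_wait: "distr M borel (wait y n) = waiting_law"
proof -
  have "distr M borel (wait y n) = distr M lborel (wait y n)"
    by (rule distr_cong) auto
  then show ?thesis
    using distributed_distr_eq_density[OF waiting_exponential[of y n]] by (simp add: waiting_law_def)
qed

lemma ring_time_eq_sum: "T y n \<omega> = (\<Sum>k\<le>n. wait y k \<omega>)"
  by (induction n) simp_all

lemma wait_0: "wait y 0 = T y 0"
  by (rule ext) simp

lemma AE_wait_pos: "AE \<omega> in M. \<forall>y n. 0 < wait y n \<omega>"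
proof -
  have "AE u in waiting_law. 0 < u"
    using AE_waiting_law_nonneg AE_waiting_law_neq[of 0] by eventually_elim simp
  then have "AE u in distr M borel (wait y n). 0 < u" for y n
    unfolding distr_wait .
  then have "AE \<omega> in M. 0 < wait y n \<omega>" for y n
    by (rule AE_distrD[OF measurable_wait])
  then show ?thesis
    by (simp add: AE_all_countable)
qed

lemma prob_waits_le:
  assumes "finite J" "0 \<le> t"
  shows "prob {\<omega> \<in> space M. \<forall>(y, k)\<in>J. wait y k \<omega> \<le> t} = (1 - exp (- t)) ^ card J"
proof (cases "J = {}")
  case True
  then show ?thesis by (simp add: prob_space)
next
  case False
  have one: "prob (wait y k -` {..t} \<inter> space M) = 1 - exp (- t)" for y k
    using exponential_distributedD_le[OF waiting_exponential[of y k] \<open>0 \<le> t\<close>]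
    by (simp add: vimage_def Int_def conj_commute)
  have "{\<omega> \<in> space M. \<forall>(y, k)\<in>J. wait y k \<omega> \<le> t} = (\<Inter>i\<in>Inr ` J. input i -` {..t} \<inter> space M)"
    using False by auto
  also have "prob \<dots> = (\<Prod>i\<in>Inr ` J. prob (input i -` {..t} \<inter> space M))"
    using False assms by (intro indep_varsD[OF indep_input]) auto
  also have "\<dots> = (\<Prod>p\<in>J. 1 - exp (- t))"
    using one by (subst prod.reindex) (auto intro!: prod.cong simp del: prod_constant)
  finally show ?thesis by simp
qed

text \<open>
  Ring times cannot accumulate: infinitely many independent waiting times do not all stay below a
  bound, and a single long waiting time delays all later rings.
\<close>

lemma AE_some_wait_gt: "AE \<omega> in M. \<forall>y t. \<exists>k. t < wait y k \<omega>"
proof -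
  have "AE \<omega> in M. \<not> (\<forall>k. wait y k \<omega> \<le> real m)" for y m
  proof (rule AE_I[OF order_refl])
    let ?N = "{\<omega> \<in> space M. \<forall>k. wait y k \<omega> \<le> real m}"
    have "prob ?N \<le> (1 - exp (- real m)) ^ n" for n
    proof -
      have "prob ?N \<le> prob {\<omega> \<in> space M. \<forall>(z, k)\<in>{y} \<times> {..<n}. wait z k \<omega> \<le> real m}"
        by (rule finite_measure_mono) auto
      also have "\<dots> = (1 - exp (- real m)) ^ n"
        by (subst prob_waits_le) (auto simp: card_cartesian_product_singleton)
      finally show ?thesis .
    qed
    moreover have "(\<lambda>n. (1 - exp (- real m)) ^ n) \<longlonglongrightarrow> 0"
      by (intro LIMSEQ_realpow_zero) auto
    ultimately have "prob ?N \<le> 0"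
      by (intro LIMSEQ_le_const) auto
    then show "emeasure M {\<omega> \<in> space M. \<not> \<not> (\<forall>k. wait y k \<omega> \<le> real m)} = 0"
      by (simp add: emeasure_eq_measure measure_le_0_iff)
  qed measurable
  then have "AE \<omega> in M. \<forall>y m. \<not> (\<forall>k. wait y k \<omega> \<le> real m)"
    by (simp add: AE_all_countable)
  then show ?thesis
  proof eventually_elim
    case (elim \<omega>)
    show ?case
    proof (intro allI)
      fix y and t :: real
      obtain m where "t \<le> real m" using real_arch_simple by blast
      moreover obtain k where "real m < wait y k \<omega>" using elim by (meson not_le)
      ultimately show "\<exists>k. t < wait y k \<omega>" by (meson le_less_trans)
    qed
  qed
qed

text \<open>
  A first ring time has a law without atoms and is independent of the ring times at another site.
\<close>

lemma AE_first_ring_alone: "AE \<omega> in M. \<forall>y z n. y \<noteq> z \<longrightarrow> T y 0 \<omega> \<noteq> T z n \<omega>"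
proof -
  have "AE \<omega> in M. T y 0 \<omega> \<noteq> T z n \<omega>" if "y \<noteq> z" for y z n
  proof -
    let ?I = "Inr ` ({z} \<times> {..n})"
    have sum: "(\<lambda>\<omega>. \<Sum>i\<in>?I. input i \<omega>) = T z n"
    proof
      fix \<omega>
      have "(\<Sum>i\<in>?I. input i \<omega>) = (\<Sum>i\<in>(\<lambda>k. Inr (z, k)) ` {..n}. input i \<omega>)"
        by (intro sum.cong) auto
      also have "\<dots> = (\<Sum>k\<le>n. wait z k \<omega>)"
        by (subst sum.reindex) (auto simp: inj_on_def)
      finally show "(\<Sum>i\<in>?I. input i \<omega>) = T z n \<omega>"
        by (simp only: ring_time_eq_sum[of z n \<omega>])
    qed
    have "indep_var borel (input (Inr (y, 0))) borel (\<lambda>\<omega>. \<Sum>i\<in>?I. input i \<omega>)"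
      using that by (intro indep_vars_sum indep_vars_subset[OF indep_input]) auto
    then have *: "indep_var borel (T y 0) borel (T z n)"
      unfolding sum by (simp only: input_simps wait_0)
    then have eq: "distr M borel (T y 0) \<Otimes>\<^sub>M distr M borel (T z n) =
        distr M (borel \<Otimes>\<^sub>M borel) (\<lambda>\<omega>. (T y 0 \<omega>, T z n \<omega>))"
      and [measurable]: "T y 0 \<in> borel_measurable M" "T z n \<in> borel_measurable M"
      unfolding indep_var_distribution_eq by auto
    have Ty: "distr M borel (T y 0) = waiting_law"
      using distr_wait[of y 0] by (simp only: wait_0)
    interpret Z: prob_space "distr M borel (T z n)"
      by (rule prob_space_distr) simp
    interpret YZ: pair_prob_space waiting_law "distr M borel (T z n)"
      by unfold_locales
    have neq_set: "{p \<in> space (waiting_law \<Otimes>\<^sub>M distr M borel (T z n)). fst p \<noteq> snd p}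
        \<in> sets (waiting_law \<Otimes>\<^sub>M distr M borel (T z n))"
      by measurable
    have "AE v in distr M borel (T z n). AE u in waiting_law. u \<noteq> v"
      using AE_waiting_law_neq by simp
    then have "AE u in waiting_law. AE v in distr M borel (T z n). u \<noteq> v"
      by (subst YZ.AE_commute[OF neq_set])
    then have "AE p in waiting_law \<Otimes>\<^sub>M distr M borel (T z n). fst p \<noteq> snd p"
      by (intro YZ.AE_pair_measure[OF neq_set]) auto
    then have "AE p in distr M (borel \<Otimes>\<^sub>M borel) (\<lambda>\<omega>. (T y 0 \<omega>, T z n \<omega>)). fst p \<noteq> snd p"
      unfolding eq[symmetric] Ty .
    then show ?thesis
      using AE_distrD[of "\<lambda>\<omega>. (T y 0 \<omega>, T z n \<omega>)" M "borel \<Otimes>\<^sub>M borel" "\<lambda>p. fst p \<noteq> snd p"] by simp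
  qed
  then have "AE \<omega> in M. y \<noteq> z \<longrightarrow> T y 0 \<omega> \<noteq> T z n \<omega>" for y z n
    by (cases "y = z") auto
  then show ?thesis
    by (simp add: AE_all_countable)
qed

lemma AE_threshold_path: "AE \<omega> in M. threshold_path (\<lambda>y n. T y n \<omega>) (\<lambda>t y. \<eta> t y \<omega>)"
  using AE_wait_pos AE_some_wait_gt AE_first_ring_alone constant_between_rings update_at_ring
proof eventually_elim
  case (elim \<omega>)
  have wait_nonneg: "0 \<le> wait y k \<omega>" for y k
    using elim(1) by (meson less_imp_le)
  have wait_le: "wait y k \<omega> \<le> T y n \<omega>" if "k \<le> n" for y k n
  proof -
    have "wait y k \<omega> \<le> (\<Sum>k\<le>n. wait y k \<omega>)"
      using that by (intro member_le_sum wait_nonneg) auto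
    then show ?thesis
      by (rule order_trans) (simp only: ring_time_eq_sum[of y n \<omega>] order_refl)
  qed
  show ?case
  proof
    show "T y 0 \<omega> \<le> T y n \<omega>" for y n
      using wait_le[of 0 n y] by simp
    show "0 < T y n \<omega>" for y n
    proof -
      have "0 < wait y 0 \<omega>" using elim(1) by blast
      then show ?thesis using wait_le[of 0 n y] by simp
    qed
    show "finite {n. T y n \<omega> \<le> t}" for y t
    proof -
      obtain k where k: "t < wait y k \<omega>" using elim(2) by blast
      have "n < k" if "T y n \<omega> \<le> t" for n
        using wait_le[of k n y] that k by (cases "k \<le> n") auto
      then have "{n. T y n \<omega> \<le> t} \<subseteq> {..<k}" by blast
      then show ?thesis by (rule finite_subset) simp
    qed
    show "T y 0 \<omega> \<noteq> T z n \<omega>" if "y \<noteq> z" for y z n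
      using elim(3) that by blast
    show "\<eta> t y \<omega> = \<eta> s y \<omega>" if "0 \<le> s" "s < t" "\<forall>n. T y n \<omega> \<notin> {s<..t}" for s t y
      using elim(4) that by blast
    show "\<eta> (T y n \<omega>) y \<omega> = median (image_mset (\<lambda>z. Lim (at_left (T y n \<omega>)) (\<lambda>r. \<eta> r z \<omega>))
        (mset_set {y - 1, y, y + 1}))" for y n
      using elim(5) by (simp add: nbhd_int_adj)
  qed
qed

definition site :: "int \<Rightarrow> 'w \<Rightarrow> real \<times> real" where
  "site y \<omega> = (\<eta> 0 y \<omega>, T y 0 \<omega>)"

lemma indep_site: "indep_vars (\<lambda>_. borel \<Otimes>\<^sub>M borel) site UNIV"
proof -
  have "indep_vars (\<lambda>y. PiM {Inl y, Inr (y, 0)} (\<lambda>_. borel))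
      (\<lambda>y \<omega>. restrict (\<lambda>i. input i \<omega>) {Inl y, Inr (y, 0)}) UNIV"
    by (intro indep_vars_restrict[OF indep_input]) (auto simp: disjoint_family_on_def)
  then have "indep_vars (\<lambda>_. borel \<Otimes>\<^sub>M borel)
      (\<lambda>y \<omega>. (\<lambda>f. (f (Inl y), f (Inr (y, 0)))) (restrict (\<lambda>i. input i \<omega>) {Inl y, Inr (y, 0)})) UNIV"
    by (rule indep_vars_compose2) measurable
  then show ?thesis
    by (simp add: site_def[abs_def])
qed

lemma measurable_site [measurable]: "site y \<in> M \<rightarrow>\<^sub>M borel \<Otimes>\<^sub>M borel"
  using indep_site by (auto simp: indep_vars_def2)

lemma distr_site: "distr M (borel \<Otimes>\<^sub>M borel) (site y) = site_law"
proof -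
  have "indep_var borel ((\<lambda>f. f (Inl y)) \<circ> (\<lambda>\<omega>. restrict (\<lambda>i. input i \<omega>) {Inl y}))
     borel ((\<lambda>f. f (Inr (y, 0))) \<circ> (\<lambda>\<omega>. restrict (\<lambda>i. input i \<omega>) {Inr (y, 0)}))"
    by (rule indep_var_compose[OF indep_var_restrict[OF indep_input]]) auto
  then have "indep_var borel (\<eta> 0 y) borel (T y 0)"
    by (simp add: comp_def wait_0)
  then have "distr M borel (\<eta> 0 y) \<Otimes>\<^sub>M distr M borel (T y 0) = distr M (borel \<Otimes>\<^sub>M borel) (site y)"
    unfolding indep_var_distribution_eq site_def[abs_def] by simp
  then show ?thesis
    using distr_wait[of y 0] initial_uniform[of y] by (simp add: site_law_def value_law_def wait_0)
qed

lemma distr_site_seq: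
  assumes "inj f"
  shows "distr M (PiM UNIV (\<lambda>_. borel \<Otimes>\<^sub>M borel)) (\<lambda>\<omega> k. site (f k) \<omega>) = seq_law"
proof -
  have all: "distr M (PiM UNIV (\<lambda>_. borel \<Otimes>\<^sub>M borel)) (\<lambda>\<omega> y. site y \<omega>) = PiM UNIV (\<lambda>_. site_law)"
    using indep_vars_iff_distr_eq_PiM[of UNIV site "\<lambda>_. borel \<Otimes>\<^sub>M borel"] indep_site
    by (simp add: distr_site restrict_def)
  have "seq_law = distr (PiM UNIV (\<lambda>_. site_law)) (PiM UNIV (\<lambda>_. site_law)) (\<lambda>w. \<lambda>k\<in>UNIV. w (f k))"
    unfolding seq_law_def
    using assms by (intro distr_PiM_reindex[symmetric] site_law.prob_space_axioms) auto
  also have "\<dots> = distr (distr M (PiM UNIV (\<lambda>_. borel \<Otimes>\<^sub>M borel)) (\<lambda>\<omega> y. site y \<omega>))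
      (PiM UNIV (\<lambda>_. borel \<Otimes>\<^sub>M borel)) (\<lambda>w k. w (f k))"
    unfolding all by (rule distr_cong) (auto intro!: sets_PiM_cong sets_site_law)
  also have "\<dots> = distr M (PiM UNIV (\<lambda>_. borel \<Otimes>\<^sub>M borel)) ((\<lambda>w k. w (f k)) \<circ> (\<lambda>\<omega> y. site y \<omega>))"
    by (rule distr_distr) (rule measurable_PiM_single', auto simp: space_pair_measure)+
  finally show ?thesis
    by (simp add: comp_def)
qed

definition half_line :: "int \<Rightarrow> int \<Rightarrow> 'w \<Rightarrow> nat \<Rightarrow> real \<times> real" where
  "half_line x d \<omega> k = site (x + d * int (Suc k)) \<omega>"

definition window :: "int \<Rightarrow> 'w \<Rightarrow> (real \<times> real) \<times> (nat \<Rightarrow> real \<times> real) \<times> (nat \<Rightarrow> real \<times> real)" where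
  "window x \<omega> = (site x \<omega>, half_line x 1 \<omega>, half_line x (-1) \<omega>)"

lemma distr_half_line:
  assumes "d = 1 \<or> d = -1"
  shows "distr M (PiM UNIV (\<lambda>_. borel \<Otimes>\<^sub>M borel)) (half_line x d) = seq_law"
  unfolding half_line_def[abs_def]
  by (rule distr_site_seq) (use assms in \<open>auto intro!: injI\<close>)

abbreviation seq_space :: "(nat \<Rightarrow> real \<times> real) measure" where
  "seq_space \<equiv> PiM UNIV (\<lambda>_. borel \<Otimes>\<^sub>M borel)"

lemma measurable_half_line [measurable]: "half_line x d \<in> M \<rightarrow>\<^sub>M seq_space"
  unfolding half_line_def[abs_def] by (rule measurable_PiM_single') (auto simp: space_pair_measure)

lemma measurable_window [measurable]:
  "window x \<in> M \<rightarrow>\<^sub>M (borel \<Otimes>\<^sub>M borel) \<Otimes>\<^sub>M seq_space \<Otimes>\<^sub>M seq_space"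
  unfolding window_def[abs_def] by measurable

lemma measurable_subfamily:
  assumes "range f \<subseteq> A"
  shows "(\<lambda>w k. w (f k)) \<in> PiM A (\<lambda>_. borel \<Otimes>\<^sub>M borel) \<rightarrow>\<^sub>M seq_space"
  using assms by (intro measurable_PiM_single') (auto simp: space_pair_measure intro!: measurable_component_singleton)

lemma distr_window:
  "distr M ((borel \<Otimes>\<^sub>M borel) \<Otimes>\<^sub>M seq_space \<Otimes>\<^sub>M seq_space) (window x) = window_law"
proof -
  let ?f = "\<lambda>d k. x + d * int (Suc k)"
  have "distr M (seq_space \<Otimes>\<^sub>M seq_space) (\<lambda>\<omega>. (half_line x 1 \<omega>, half_line x (-1) \<omega>)) =
      distr M seq_space (half_line x 1) \<Otimes>\<^sub>M distr M seq_space (half_line x (-1))"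
    by (rule distr_pair_blocks[OF indep_site, where A = "{x<..}" and B = "{..<x}"
          and f = "\<lambda>w k. w (?f 1 k)" and g = "\<lambda>w k. w (?f (-1) k)"])
      (auto intro!: measurable_subfamily simp: half_line_def fun_eq_iff)
  then have halves: "distr M (seq_space \<Otimes>\<^sub>M seq_space) (\<lambda>\<omega>. (half_line x 1 \<omega>, half_line x (-1) \<omega>)) =
      seq_law \<Otimes>\<^sub>M seq_law"
    by (simp add: distr_half_line)
  let ?g = "\<lambda>w. ((\<lambda>k. w (?f 1 k)), (\<lambda>k. w (?f (-1) k)))"
  have "distr M ((borel \<Otimes>\<^sub>M borel) \<Otimes>\<^sub>M seq_space \<Otimes>\<^sub>M seq_space) (window x) =
      distr M (borel \<Otimes>\<^sub>M borel) (site x) \<Otimes>\<^sub>M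
      distr M (seq_space \<Otimes>\<^sub>M seq_space) (\<lambda>\<omega>. (half_line x 1 \<omega>, half_line x (-1) \<omega>))"
    unfolding window_def[abs_def]
    by (rule distr_pair_blocks[OF indep_site, where A = "{x}" and B = "- {x}"
          and f = "\<lambda>w. w x" and g = ?g])
      (auto intro!: measurable_subfamily measurable_Pair measurable_component_singleton
        simp: half_line_def fun_eq_iff)
  then show ?thesis
    by (simp add: distr_site halves)
qed

end

section \<open>The distribution of a value\<close>

lemma (in threshold_path) col_eq_flip:
  assumes "0 \<le> t"
    and far: "\<And>d. d \<in> {1, -1} \<Longrightarrow> \<exists>k<n. t < T (y + d * int (Suc k)) 0"
  defines "W \<equiv> ((h 0 y, T y 0), (\<lambda>k. (h 0 (y + 1 * int (Suc k)), T (y + 1 * int (Suc k)) 0)),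
      (\<lambda>k. (h 0 (y + (-1) * int (Suc k)), T (y + (-1) * int (Suc k)) 0)))"
  shows "of_bool (col t y) =
    of_bool (col 0 y) - of_bool (flips a n t True W) + (of_bool (flips a n t False W) :: real)"
proof (cases "T y 0 \<le> t")
  case True
  let ?W = "\<lambda>d k. (h 0 (y + d * int (Suc k)), T (y + d * int (Suc k)) 0)"
  have side: "col_before (T y 0) (y + d) \<noteq> col 0 y \<longleftrightarrow> disagree a n (col 0 y) (T y 0) (?W d)"
    if d: "d \<in> {1, -1}" for d
  proof (rule disagreement_iff_disagree)
    obtain k where "k < n" "t < T (y + d * int (Suc k)) 0"
      using far[OF d] by blast
    with True show "\<exists>k<n. T y 0 \<le> T (y + d * int (Suc k)) 0"
      by (meson less_imp_le order_trans)
  qed (use d ring_pos in auto)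
  have "flips a n t c W \<longleftrightarrow> col 0 y = c \<and> col_before (T y 0) (y + 1) \<noteq> col 0 y \<and>
      col_before (T y 0) (y - 1) \<noteq> col 0 y" for c
    using True side[of 1] side[of "-1"] by (auto simp: flips_def W_def col_def)
  then show ?thesis
    using col_eq[OF \<open>0 \<le> t\<close>, of y] True by auto
next
  case False
  then show ?thesis
    using col_eq[OF \<open>0 \<le> t\<close>, of y] by (simp add: flips_def W_def)
qed

context int_median_dynamics
begin

lemma integral_flip_window:
  "(\<integral>\<omega>. of_bool (flips a n t c (window x \<omega>)) \<partial>M) = (\<integral>z. (of_bool (flips a n t c z) :: real) \<partial>window_law)"
proof -
  have "(\<lambda>z. of_bool (flips a n t c z) :: real) \<in> borel_measurable window_law"
    by (simp add: of_bool_def)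
  moreover have "sets window_law = sets ((borel \<Otimes>\<^sub>M borel) \<Otimes>\<^sub>M seq_space \<Otimes>\<^sub>M seq_space)"
    by (intro sets_pair_measure_cong sets_site_law sets_seq_law)
  ultimately have "(\<lambda>z. of_bool (flips a n t c z) :: real) \<in>
      borel_measurable ((borel \<Otimes>\<^sub>M borel) \<Otimes>\<^sub>M seq_space \<Otimes>\<^sub>M seq_space)"
    using measurable_cong_sets by blast
  then show ?thesis
    unfolding distr_window[of x, symmetric] by (subst integral_distr) auto
qed

lemma prob_initial_le:
  assumes "a \<in> {0..1}"
  shows "(\<integral>\<omega>. of_bool (\<eta> 0 x \<omega> \<le> a) \<partial>M) = a"
proof -
  have "(\<integral>\<omega>. of_bool (\<eta> 0 x \<omega> \<le> a) \<partial>M) = (\<integral>v. (of_bool (v \<le> a) :: real) \<partial>distr M borel (\<eta> 0 x))"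
    by (subst integral_distr) (auto simp: of_bool_def)
  also have "distr M borel (\<eta> 0 x) = value_law"
    by (simp add: initial_uniform value_law_def)
  finally show ?thesis
    using prob_colour[OF assms, of True] by (simp add: prob_neq_colour_def)
qed

text \<open>
  The cut-off matters only if all of the first \<open>n\<close> sites on one of the two sides ring by time \<open>t\<close>.
\<close>

lemma prob_le_approx:
  assumes a: "a \<in> {0..1}" and t: "0 \<le> t"
  shows "\<bar>prob {\<omega> \<in> space M. \<eta> t x \<omega> \<le> a} - (a -
    ((\<integral>z. of_bool (flips a n t True z) \<partial>window_law) - (\<integral>z. of_bool (flips a n t False z) \<partial>window_law)))\<bar>
    \<le> 2 * (1 - exp (- t)) ^ n"
proof -
  let ?early = "\<lambda>d \<omega>. \<forall>(y, k)\<in>(\<lambda>k. (x + d * int (Suc k), 0 :: nat)) ` {..<n}. wait y k \<omega> \<le> t"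
  define E where "E d = {\<omega> \<in> space M. ?early d \<omega>}" for d
  let ?f = "\<lambda>c \<omega>. of_bool (flips a n t c (window x \<omega>)) :: real"
  let ?D = "\<lambda>\<omega>. of_bool (\<eta> t x \<omega> \<le> a) - (of_bool (\<eta> 0 x \<omega> \<le> a) - ?f True \<omega> + ?f False \<omega>)"
  have [measurable]: "\<eta> t x \<in> borel_measurable M"
    using measurable_value t .
  have "sets window_law = sets ((borel \<Otimes>\<^sub>M borel) \<Otimes>\<^sub>M seq_space \<Otimes>\<^sub>M seq_space)"
    by (intro sets_pair_measure_cong sets_site_law sets_seq_law)
  then have "Measurable.pred M (\<lambda>\<omega>. flips a n t c (window x \<omega>))" for c
    using measurable_flip[of a n t c] measurable_window[of x]
    by (metis (no_types) measurable_compose measurable_cong_sets)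
  then have f: "integrable M (?f c)" for c
    by (intro integrable_const_bound[of _ 1]) (auto simp: of_bool_def)
  have i0: "integrable M (\<lambda>\<omega>. of_bool (\<eta> s x \<omega> \<le> a) :: real)" if "0 \<le> s" for s
    using measurable_value[OF that, of x] by (intro integrable_const_bound[of _ 1]) (auto simp: of_bool_def)
  have E: "E d \<in> sets M" for d
  proof -
    have [measurable]: "T y 0 \<in> borel_measurable M" for y
      using measurable_wait[of y 0] unfolding wait_0 .
    show ?thesis by (simp add: E_def)
  qed
  have prob_E: "prob (E d) = (1 - exp (- t)) ^ n" if "d \<noteq> 0" for d
    unfolding E_def using that t by (subst prob_waits_le) (auto simp: card_image inj_on_def)
  have "AE \<omega> in M. \<bar>?D \<omega>\<bar> \<le> indicator (E 1) \<omega> + indicator (E (-1)) \<omega>"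
    using AE_threshold_path AE_space
  proof eventually_elim
    case (elim \<omega>)
    interpret threshold_path "\<lambda>y n. T y n \<omega>" "\<lambda>t y. \<eta> t y \<omega>" a by fact
    show ?case
    proof (cases "?early 1 \<omega> \<or> ?early (-1) \<omega>")
      case True
      \<comment> \<open>A flip from the colour \<open>c\<close> requires the initial colour \<open>c\<close>, so the bracket is 0 or 1.\<close>
      have "\<bar>?D \<omega>\<bar> \<le> 1"
        by (auto simp: flips_def window_def site_def)
      with True elim(2) show ?thesis by (auto simp: indicator_def E_def)
    next
      case False
      then have "\<exists>k<n. t < T (x + d * int (Suc k)) 0 \<omega>" if "d \<in> {1, -1}" for d
        using that by (force simp: not_le)
      from col_eq_flip[OF t this] have "?D \<omega> = 0"
        by (simp add: window_def half_line_def[abs_def] site_def col_def)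
      then show ?thesis by simp
    qed
  qed
  then have "\<bar>\<integral>\<omega>. ?D \<omega> \<partial>M\<bar> \<le> (\<integral>\<omega>. indicator (E 1) \<omega> + indicator (E (-1)) \<omega> \<partial>M)"
    using E f i0[OF t] i0[of 0]
    by (intro order_trans[OF integral_abs_bound] integral_mono_AE) (auto simp: less_top[symmetric])
  also have "\<dots> = 2 * (1 - exp (- t)) ^ n"
    using E prob_E by (simp add: less_top[symmetric])
  also have "(\<integral>\<omega>. ?D \<omega> \<partial>M) = prob {\<omega> \<in> space M. \<eta> t x \<omega> \<le> a} - (a -
    ((\<integral>z. of_bool (flips a n t True z) \<partial>window_law) - (\<integral>z. of_bool (flips a n t False z) \<partial>window_law)))"
  proof -
    have "(\<integral>\<omega>. (of_bool (\<eta> t x \<omega> \<le> a) :: real) \<partial>M) = (\<integral>\<omega>. indicator {\<omega> \<in> space M. \<eta> t x \<omega> \<le> a} \<omega> \<partial>M)"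
      by (intro Bochner_Integration.integral_cong) (auto simp: indicator_def)
    then have "(\<integral>\<omega>. (of_bool (\<eta> t x \<omega> \<le> a) :: real) \<partial>M) = prob {\<omega> \<in> space M. \<eta> t x \<omega> \<le> a}"
      by simp
    then show ?thesis
      using f i0[OF t] i0[of 0] prob_initial_le[OF a, of x] by (simp add: integral_flip_window)
  qed
  finally show ?thesis .
qed

lemma prob_value_le:
  assumes a: "a \<in> {0..1}" and t: "0 \<le> t"
  shows "prob {\<omega> \<in> space M. \<eta> t x \<omega> \<le> a} = a - (1 - exp (- t)) * (a * (1 - a) * (1 - 2 * a))"
proof -
  let ?P = "prob {\<omega> \<in> space M. \<eta> t x \<omega> \<le> a}"
  let ?A = "\<lambda>n. a - ((\<integral>z. of_bool (flips a n t True z) \<partial>window_law) - (\<integral>z. of_bool (flips a n t False z) \<partial>window_law))"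
  have "(\<lambda>n. (1 - exp (- t)) ^ n) \<longlonglongrightarrow> 0"
    using t by (intro LIMSEQ_realpow_zero) auto
  then have "(\<lambda>n. 2 * (1 - exp (- t)) ^ n) \<longlonglongrightarrow> 0"
    by (rule tendsto_mult_right_zero)
  then have "(\<lambda>n. ?P - ?A n) \<longlonglongrightarrow> 0"
    by (rule Lim_null_comparison[rotated]) (use prob_le_approx[OF a t] in simp)
  moreover have "(\<lambda>n. ?P - ?A n) \<longlonglongrightarrow> ?P - (a - (1 - exp (- t)) * (a * (1 - a) * (1 - 2 * a)))"
    by (intro tendsto_intros flip_imbalance_tendsto[OF a t])
  ultimately have "?P - (a - (1 - exp (- t)) * (a * (1 - a) * (1 - 2 * a))) = 0"
    using LIMSEQ_unique by blast
  then show ?thesis by simp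
qed

text \<open>
  A mixture of the uniform density and the density of the median of three independent uniform
  variables.
\<close>

definition value_density :: "real \<Rightarrow> real \<Rightarrow> real" where
  "value_density t u = exp (- t) + (1 - exp (- t)) * (6 * u * (1 - u))"

lemma value_density_nonneg:
  assumes "0 \<le> t" "u \<in> {0..1}"
  shows "0 \<le> value_density t u"
  unfolding value_density_def using assms by (intro add_nonneg_nonneg mult_nonneg_nonneg) auto

lemma distributed_value:
  assumes t: "0 \<le> t"
  shows "distributed M lborel (\<eta> t x) (\<lambda>u. ennreal (value_density t u * indicator {0..1} u))"
proof (rule distributedI_borel_atMost)
  let ?c = "1 - exp (- t)"
  let ?F = "\<lambda>a. a - ?c * (a * (1 - a) * (1 - 2 * a))"
  \<comment> \<open>The polynomial is the distribution function on the unit interval only, so its argument is clamped.\<close>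
  let ?G = "\<lambda>b. ?F (max 0 (min 1 b))"
  show [measurable]: "\<eta> t x \<in> borel_measurable M"
    using measurable_value t .
  show "(\<lambda>u. value_density t u * indicator {0..1} u) \<in> borel_measurable borel"
    unfolding value_density_def by measurable
  show "AE u in lborel. 0 \<le> value_density t u * indicator {0..1} u"
    using value_density_nonneg[OF t] by (auto simp: indicator_def)
  have range: "\<eta> t x \<omega> \<in> {0..1}" if "\<omega> \<in> space M" for \<omega>
    using state_space[OF t that] .
  fix b :: real
  show "(\<integral>\<^sup>+ u. ennreal (value_density t u * indicator {0..1} u * indicator {..b} u) \<partial>lborel) = ennreal (?G b)"
  proof (cases "b < 0")
    case True
    have "(\<integral>\<^sup>+ u. ennreal (value_density t u * indicator {0..1} u * indicator {..b} u) \<partial>lborel) = (\<integral>\<^sup>+ u. 0 \<partial>(lborel :: real measure))"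
      using True by (intro nn_integral_cong) (auto simp: indicator_def)
    then show ?thesis using True by simp
  next
    case False
    let ?m = "max 0 (min 1 b)"
    have "(\<integral>\<^sup>+ u. ennreal (value_density t u * indicator {0..1} u * indicator {..b} u) \<partial>lborel) =
        (\<integral>\<^sup>+ u. ennreal (value_density t u) * indicator {0..?m} u \<partial>lborel)"
      using False by (intro nn_integral_cong) (auto simp: indicator_def)
    also have "\<dots> = ennreal (?F ?m - ?F 0)"
    proof (rule nn_integral_FTC_Icc)
      fix u assume u: "u \<in> {0..?m}"
      then have "u \<in> {0..1}" by auto
      then show "0 \<le> value_density t u" by (rule value_density_nonneg[OF t])
      show "(?F has_real_derivative value_density t u) (at u)"
        unfolding value_density_def by (auto intro!: derivative_eq_intros simp: algebra_simps)
    qed (auto simp: value_density_def)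
    finally show ?thesis by simp
  qed
  show "emeasure M {\<omega> \<in> space M. \<eta> t x \<omega> \<le> b} = ennreal (?G b)"
  proof -
    consider "b < 0" | "b \<in> {0..1}" | "1 < b" by fastforce
    then have "prob {\<omega> \<in> space M. \<eta> t x \<omega> \<le> b} = ?G b"
    proof cases
      case 1
      then have *: "{\<omega> \<in> space M. \<eta> t x \<omega> \<le> b} = {}"
        using range by fastforce
      show ?thesis unfolding * using 1 by simp
    next
      case 2
      then show ?thesis using prob_value_le[OF 2 t, of x] by simp
    next
      case 3
      then have *: "{\<omega> \<in> space M. \<eta> t x \<omega> \<le> b} = space M"
        using range by fastforce
      show ?thesis unfolding * using 3 by (simp add: prob_space)
    qed
    then show ?thesis by (simp add: emeasure_eq_measure)
  qed
qed

lemma distributed_value_unit_interval: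
  assumes t: "0 \<le> t"
  shows "distributed M (restrict_space lborel {0..1}) (\<eta> t x) (\<lambda>u. ennreal (value_density t u))"
proof -
  have [measurable]: "\<eta> t x \<in> borel_measurable M"
    using measurable_value t .
  have [measurable]: "value_density t \<in> borel_measurable borel"
    unfolding value_density_def[abs_def] by measurable
  have X: "\<eta> t x \<in> M \<rightarrow>\<^sub>M restrict_space lborel {0..1}"
    using state_space[OF t] by (intro measurable_restrict_space2) auto
  have p: "(\<lambda>u. ennreal (value_density t u)) \<in> borel_measurable (restrict_space lborel {0..1})"
    by (rule measurable_restrict_space1) simp
  have "distr M (restrict_space lborel {0..1}) (\<eta> t x) = density (restrict_space lborel {0..1}) (\<lambda>u. ennreal (value_density t u))"
  proof (rule measure_eqI)
    fix A assume "A \<in> sets (distr M (restrict_space lborel {0..1}) (\<eta> t x))"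
    then have A: "A \<in> sets (restrict_space lborel {0..1})" by simp
    then have A': "A \<in> sets lborel" "A \<subseteq> {0..1}"
      by (auto simp: sets_restrict_space)
    have "emeasure (distr M (restrict_space lborel {0..1}) (\<eta> t x)) A = emeasure M (\<eta> t x -` A \<inter> space M)"
      using X A by (rule emeasure_distr)
    also have "\<dots> = (\<integral>\<^sup>+ u. ennreal (value_density t u * indicator {0..1} u) * indicator A u \<partial>lborel)"
      using distributed_emeasure[OF distributed_value[OF t] A'(1)] .
    also have "\<dots> = (\<integral>\<^sup>+ u. ennreal (value_density t u) * indicator A u * indicator {0..1} u \<partial>lborel)"
      by (intro nn_integral_cong) (auto simp: indicator_def)
    also have "\<dots> = (\<integral>\<^sup>+ u. ennreal (value_density t u) * indicator A u \<partial>restrict_space lborel {0..1})"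
      by (subst nn_integral_restrict_space) auto
    also have "\<dots> = emeasure (density (restrict_space lborel {0..1}) (\<lambda>u. ennreal (value_density t u))) A"
      using p A by (subst emeasure_density) auto
    finally show "emeasure (distr M (restrict_space lborel {0..1}) (\<eta> t x)) A =
        emeasure (density (restrict_space lborel {0..1}) (\<lambda>u. ennreal (value_density t u))) A" .
  qed simp
  with X p show ?thesis
    unfolding distributed_def by blast
qed

lemma prob_value_less:
  assumes a: "a \<in> {0..1}" and t: "0 \<le> t"
  shows "prob {\<omega> \<in> space M. \<eta> t x \<omega> \<in> {0..<a}} = a - (1 - exp (- t)) * (a * (1 - a) * (1 - 2 * a))"
proof -
  have [measurable]: "\<eta> t x \<in> borel_measurable M"
    using measurable_value t .
  have "AE u in lborel. ennreal (value_density t u * indicator {0..1} u) > 0 \<longrightarrow> u \<noteq> a"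
    using AE_lborel_singleton[of a] by eventually_elim simp
  then have "AE \<omega> in M. \<eta> t x \<omega> \<noteq> a"
    using distributed_AE2[OF distributed_value[OF t], of "\<lambda>u. u \<noteq> a"] by simp
  then have "AE \<omega> in M. \<eta> t x \<omega> \<in> {0..<a} \<longleftrightarrow> \<eta> t x \<omega> \<le> a"
    using AE_space by eventually_elim (use state_space[OF t] in auto)
  then have "prob {\<omega> \<in> space M. \<eta> t x \<omega> \<in> {0..<a}} = prob {\<omega> \<in> space M. \<eta> t x \<omega> \<le> a}"
    by (intro measure_eq_AE) auto
  then show ?thesis
    using prob_value_le[OF a t] by simp
qed

lemma antimono_prob_less:
  assumes a: "a \<in> {0..1/2}"
  shows "antimono_on {0..} (\<lambda>t. prob {\<omega> \<in> space M. \<eta> t x \<omega> \<in> {0..<a}})"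
proof (rule monotone_onI)
  fix s t :: real assume st: "s \<in> {0..}" "t \<in> {0..}" "s \<le> t"
  have "0 \<le> a * (1 - a) * (1 - 2 * a)"
    using a by (intro mult_nonneg_nonneg) auto
  then have "(1 - exp (- s)) * (a * (1 - a) * (1 - 2 * a)) \<le> (1 - exp (- t)) * (a * (1 - a) * (1 - 2 * a))"
    using st by (intro mult_right_mono) auto
  then show "prob {\<omega> \<in> space M. \<eta> s x \<omega> \<in> {0..<a}} \<ge> prob {\<omega> \<in> space M. \<eta> t x \<omega> \<in> {0..<a}}"
    using a st by (subst (1 2) prob_value_less) auto
qed

lemma value_density_sym: "value_density t u = value_density t (1 - u)"
  by (simp add: value_density_def algebra_simps)

lemma mono_value_density:
  assumes "0 \<le> t"
  shows "mono_on {0..1/2} (value_density t)"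
proof (rule mono_onI)
  fix u v :: real assume uv: "u \<in> {0..1/2}" "v \<in> {0..1/2}" "u \<le> v"
  have "v * (1 - v) - u * (1 - u) = (v - u) * (1 - u - v)"
    by (simp add: algebra_simps)
  also have "\<dots> \<ge> 0"
    using uv by (intro mult_nonneg_nonneg) auto
  finally have "u * (1 - u) \<le> v * (1 - v)" by simp
  then show "value_density t u \<le> value_density t v"
    unfolding value_density_def using assms by (intro add_left_mono mult_left_mono) auto
qed

end

theorem proposition3p11:
  fixes M :: "'w measure"
    and T :: "int \<Rightarrow> nat \<Rightarrow> 'w \<Rightarrow> real"
    and \<eta> :: "real \<Rightarrow> int \<Rightarrow> 'w \<Rightarrow> real"
    and x :: int
  assumes "median_dynamics M int_adj T \<eta>"
  shows "(\<forall>\<alpha>\<in>{0..1/2::real}.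
            antimono_on {0..} (\<lambda>t::real. measure M {\<omega> \<in> space M. \<eta> t x \<omega> \<in> {0..<\<alpha>}}))
       \<and> (\<forall>t\<ge>0. \<exists>p :: real \<Rightarrow> real.
            (\<forall>u\<in>{0..1}. 0 \<le> p u) \<and>
            distributed M (restrict_space lborel {0..1}) (\<eta> t x) (\<lambda>u. ennreal (p u)) \<and>
            (\<forall>u\<in>{0..1}. p u = p (1 - u)) \<and>
            mono_on {0..1/2} p)"
proof -
  interpret median_dynamics M int_adj T \<eta> by fact
  interpret int_median_dynamics M T \<eta> ..
  have "\<exists>p :: real \<Rightarrow> real. (\<forall>u\<in>{0..1}. 0 \<le> p u) \<and>
            distributed M (restrict_space lborel {0..1}) (\<eta> t x) (\<lambda>u. ennreal (p u)) \<and>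
            (\<forall>u\<in>{0..1}. p u = p (1 - u)) \<and> mono_on {0..1/2} p" if "0 \<le> t" for t
    using value_density_nonneg[OF that] distributed_value_unit_interval[OF that] value_density_sym[of t] mono_value_density[OF that]
    by (intro exI[of _ "value_density t"]) auto
  then show ?thesis
    using antimono_prob_less by blast
qed

end
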